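(* Let $\Bbbk$ be a field and let $A$ be a Poisson algebra over $\Bbbk$. (1) If $A$ is noetherian with artinian Poisson center, then $A$ is Poisson cancellative. (2) If $A$ has trivial Poisson center, then $A$ is Poisson cancellative.
   Context: A Poisson algebra over a field $\Bbbk$ is a commutative $\Bbbk$-algebra $A$ with a $\Bbbk$-bilinear bracket $\{\,,\}$ making $A$ a Lie algebra and such that $\{a,-\}$ is a $\Bbbk$-derivation of $A$ for every $a\in A$. Isomorphisms are bijective $\Bbbk$-algebra homomorphisms preserving brackets. The Poisson center is $\mathcal Z_P(A)=\{z\in A:\{z,a\}=0\text{ for all }a\in A\}$, and $A$ has trivial Poisson center if $\mathcal Z_P(A)=\Bbbk$. The polynomial algebra $A[t]$ carries the Poisson bracket extending that of $A$ with $\{t,a\}=0$ for all $a\in A$. $A$ is Poisson cancellative if for every Poisson algebra $B$ over $\Bbbk$, an isomorphism of Poisson algebras $A[t]\cong B[t]$ implies $A\cong B$ as Poisson algebras. *)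

theory Defs
  imports "HOL-Algebra.Algebra"
begin

record ('k, 'a) poisson = "('k, 'a) module" +
  pbracket :: "'a \<Rightarrow> 'a \<Rightarrow> 'a" (\<open>\<lbrace>_,/ _\<rbrace>\<index>\<close>)

text \<open>
  The locale \<open>algebra\<close> supplies a commutative associative algebra with unit. The Lie
  bracket is required to be alternating rather than antisymmetric, which matters in
  characteristic 2. Linearity of the derivation \<open>{a, -}\<close> is part of bilinearity.
\<close>

locale poisson_algebra = algebra K A + K: field K
  for K :: "('k, 'm) ring_scheme" (structure) and A :: "('k, 'a, 'n) poisson_scheme" (structure) +
  assumes pbracket_closed [simp, intro]:
      "\<lbrakk>a \<in> carrier A; b \<in> carrier A\<rbrakk> \<Longrightarrow> \<lbrace>a, b\<rbrace>\<^bsub>A\<^esub> \<in> carrier A"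
    and pbracket_add_left:
      "\<lbrakk>a \<in> carrier A; b \<in> carrier A; c \<in> carrier A\<rbrakk>
        \<Longrightarrow> \<lbrace>a \<oplus>\<^bsub>A\<^esub> b, c\<rbrace>\<^bsub>A\<^esub> = \<lbrace>a, c\<rbrace>\<^bsub>A\<^esub> \<oplus>\<^bsub>A\<^esub> \<lbrace>b, c\<rbrace>\<^bsub>A\<^esub>"
    and pbracket_add_right:
      "\<lbrakk>a \<in> carrier A; b \<in> carrier A; c \<in> carrier A\<rbrakk>
        \<Longrightarrow> \<lbrace>a, b \<oplus>\<^bsub>A\<^esub> c\<rbrace>\<^bsub>A\<^esub> = \<lbrace>a, b\<rbrace>\<^bsub>A\<^esub> \<oplus>\<^bsub>A\<^esub> \<lbrace>a, c\<rbrace>\<^bsub>A\<^esub>"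
    and pbracket_smult_left:
      "\<lbrakk>r \<in> carrier K; a \<in> carrier A; b \<in> carrier A\<rbrakk>
        \<Longrightarrow> \<lbrace>r \<odot>\<^bsub>A\<^esub> a, b\<rbrace>\<^bsub>A\<^esub> = r \<odot>\<^bsub>A\<^esub> \<lbrace>a, b\<rbrace>\<^bsub>A\<^esub>"
    and pbracket_smult_right:
      "\<lbrakk>r \<in> carrier K; a \<in> carrier A; b \<in> carrier A\<rbrakk>
        \<Longrightarrow> \<lbrace>a, r \<odot>\<^bsub>A\<^esub> b\<rbrace>\<^bsub>A\<^esub> = r \<odot>\<^bsub>A\<^esub> \<lbrace>a, b\<rbrace>\<^bsub>A\<^esub>"
    and pbracket_self: "a \<in> carrier A \<Longrightarrow> \<lbrace>a, a\<rbrace>\<^bsub>A\<^esub> = \<zero>\<^bsub>A\<^esub>"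
    and pbracket_jacobi:
      "\<lbrakk>a \<in> carrier A; b \<in> carrier A; c \<in> carrier A\<rbrakk>
        \<Longrightarrow> \<lbrace>a, \<lbrace>b, c\<rbrace>\<^bsub>A\<^esub>\<rbrace>\<^bsub>A\<^esub> \<oplus>\<^bsub>A\<^esub> \<lbrace>b, \<lbrace>c, a\<rbrace>\<^bsub>A\<^esub>\<rbrace>\<^bsub>A\<^esub> \<oplus>\<^bsub>A\<^esub> \<lbrace>c, \<lbrace>a, b\<rbrace>\<^bsub>A\<^esub>\<rbrace>\<^bsub>A\<^esub> = \<zero>\<^bsub>A\<^esub>"
    and pbracket_leibniz:
      "\<lbrakk>a \<in> carrier A; b \<in> carrier A; c \<in> carrier A\<rbrakk>
        \<Longrightarrow> \<lbrace>a, b \<otimes>\<^bsub>A\<^esub> c\<rbrace>\<^bsub>A\<^esub> = \<lbrace>a, b\<rbrace>\<^bsub>A\<^esub> \<otimes>\<^bsub>A\<^esub> c \<oplus>\<^bsub>A\<^esub> b \<otimes>\<^bsub>A\<^esub> \<lbrace>a, c\<rbrace>\<^bsub>A\<^esub>"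

definition poisson_iso ::
  "('k, 'm) ring_scheme \<Rightarrow> ('k, 'a, 'n) poisson_scheme \<Rightarrow> ('k, 'b, 'p) poisson_scheme \<Rightarrow> ('a \<Rightarrow> 'b) set"
  where "poisson_iso K A B = {h \<in> ring_iso A B.
    (\<forall>r \<in> carrier K. \<forall>a \<in> carrier A. h (r \<odot>\<^bsub>A\<^esub> a) = r \<odot>\<^bsub>B\<^esub> h a) \<and>
    (\<forall>a \<in> carrier A. \<forall>b \<in> carrier A. h \<lbrace>a, b\<rbrace>\<^bsub>A\<^esub> = \<lbrace>h a, h b\<rbrace>\<^bsub>B\<^esub>)}"

definition poisson_isomorphic ::
  "('k, 'm) ring_scheme \<Rightarrow> ('k, 'a, 'n) poisson_scheme \<Rightarrow> ('k, 'b, 'p) poisson_scheme \<Rightarrow> bool"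
  where "poisson_isomorphic K A B \<longleftrightarrow> poisson_iso K A B \<noteq> {}"

definition poisson_center :: "('k, 'a, 'n) poisson_scheme \<Rightarrow> 'a set"
  where "poisson_center A = {z \<in> carrier A. \<forall>a \<in> carrier A. \<lbrace>z, a\<rbrace>\<^bsub>A\<^esub> = \<zero>\<^bsub>A\<^esub>}"

text \<open>The base field is identified with its image under the structure map of the algebra.\<close>

definition trivial_poisson_center :: "('k, 'm) ring_scheme \<Rightarrow> ('k, 'a, 'n) poisson_scheme \<Rightarrow> bool"
  where "trivial_poisson_center K A \<longleftrightarrow> poisson_center A = (\<lambda>r. r \<odot>\<^bsub>A\<^esub> \<one>\<^bsub>A\<^esub>) ` carrier K"

text \<open>
  \<open>UP A\<close> is the polynomial ring in one variable over the ring \<open>A\<close>, its elements being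
  coefficient sequences; its own scalar multiplication is by \<open>A\<close> and is replaced here
  by scalar multiplication by the base field.
  As the variable is Poisson central, biderivation forces
  \<open>{sum a_i t^i, sum b_j t^j} = sum {a_i, b_j} t^(i + j)\<close>.
\<close>

definition poisson_poly :: "('k, 'a, 'n) poisson_scheme \<Rightarrow> ('k, nat \<Rightarrow> 'a) poisson"
  where "poisson_poly A = \<lparr>
    carrier = carrier (UP A),
    monoid.mult = (\<otimes>\<^bsub>UP A\<^esub>),
    monoid.one = \<one>\<^bsub>UP A\<^esub>,
    ring.zero = \<zero>\<^bsub>UP A\<^esub>,
    ring.add = (\<oplus>\<^bsub>UP A\<^esub>),
    smult = (\<lambda>r p n. r \<odot>\<^bsub>A\<^esub> p n),
    pbracket = (\<lambda>p q n. \<Oplus>\<^bsub>A\<^esub>i \<in> {..n}. \<lbrace>p i, q (n - i)\<rbrace>\<^bsub>A\<^esub>)\<rparr>"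

locale artinian_ring = ring +
  assumes descending_chain:
    "\<lbrakk>\<And>n :: nat. ideal (I n) R; decseq I\<rbrakk> \<Longrightarrow> \<exists>N. \<forall>n \<ge> N. I n = I N"

text \<open>
  The argument of type \<open>'b itself\<close> fixes the type containing the carrier of the competing
  algebra \<open>B\<close>. A statement proved with \<open>'b\<close> a type variable covers every \<open>B\<close>.
\<close>

definition poisson_cancellative ::
  "'b itself \<Rightarrow> ('k, 'm) ring_scheme \<Rightarrow> ('k, 'a, 'n) poisson_scheme \<Rightarrow> bool"
  where "poisson_cancellative TYPE('b) K A \<longleftrightarrow>
    (\<forall>B :: ('k, 'b) poisson. poisson_algebra K B \<longrightarrow>
      poisson_isomorphic K (poisson_poly A) (poisson_poly B) \<longrightarrow> poisson_isomorphic K A B)"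

context poisson_algebra
begin

lemma pbracket_zero_left: "b \<in> carrier A \<Longrightarrow> \<lbrace>\<zero>\<^bsub>A\<^esub>, b\<rbrace>\<^bsub>A\<^esub> = \<zero>\<^bsub>A\<^esub>"
  using pbracket_smult_left[of "\<zero>" "\<zero>\<^bsub>A\<^esub>" b] by simp

lemma pbracket_zero_right: "a \<in> carrier A \<Longrightarrow> \<lbrace>a, \<zero>\<^bsub>A\<^esub>\<rbrace>\<^bsub>A\<^esub> = \<zero>\<^bsub>A\<^esub>"
  using pbracket_smult_right[of "\<zero>" a "\<zero>\<^bsub>A\<^esub>"] by simp

lemma pbracket_one_left:
  assumes b: "b \<in> carrier A" shows "\<lbrace>\<one>\<^bsub>A\<^esub>, b\<rbrace>\<^bsub>A\<^esub> = \<zero>\<^bsub>A\<^esub>"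
proof -
  note simps = cring.cring_simprules[OF M_cring]
  have one: "\<one>\<^bsub>A\<^esub> \<in> carrier A" by (rule simps)
  let ?x = "\<lbrace>b, \<one>\<^bsub>A\<^esub>\<rbrace>\<^bsub>A\<^esub>" and ?y = "\<lbrace>\<one>\<^bsub>A\<^esub>, b\<rbrace>\<^bsub>A\<^esub>"
  have "?x = ?x \<oplus>\<^bsub>A\<^esub> ?x"
    using pbracket_leibniz[of b "\<one>\<^bsub>A\<^esub>" "\<one>\<^bsub>A\<^esub>"] b one by (simp add: simps)
  then have x: "?x = \<zero>\<^bsub>A\<^esub>"
    using b one by (metis M.add.l_cancel_one' pbracket_closed)
  have "\<zero>\<^bsub>A\<^esub> = \<lbrace>b \<oplus>\<^bsub>A\<^esub> \<one>\<^bsub>A\<^esub>, b \<oplus>\<^bsub>A\<^esub> \<one>\<^bsub>A\<^esub>\<rbrace>\<^bsub>A\<^esub>"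
    using b one by (simp add: pbracket_self)
  also have "\<dots> = ?y"
    using b one x by (simp add: pbracket_add_left pbracket_add_right pbracket_self[OF b] pbracket_self[OF one])
  finally show ?thesis by simp
qed

lemma pbracket_monom:
  assumes a: "a \<in> carrier A" and b: "b \<in> carrier A"
  shows "\<lbrace>up_ring.monom (UP A) a i, up_ring.monom (UP A) b j\<rbrace>\<^bsub>poisson_poly A\<^esub> = up_ring.monom (UP A) \<lbrace>a, b\<rbrace>\<^bsub>A\<^esub> (i + j)"
proof
  fix n
  let ?f = "\<lambda>l. if l = i \<and> n - l = j then \<lbrace>a, b\<rbrace>\<^bsub>A\<^esub> else \<zero>\<^bsub>A\<^esub>"
  have "\<lbrace>up_ring.monom (UP A) a i, up_ring.monom (UP A) b j\<rbrace>\<^bsub>poisson_poly A\<^esub> n = (\<Oplus>\<^bsub>A\<^esub>l \<in> {..n}. ?f l)"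
    using a b unfolding poisson_poly_def UP_def
    by (auto intro!: M.finsum_cong' simp: pbracket_zero_left pbracket_zero_right)
  also have "\<dots> = (if n = i + j then \<lbrace>a, b\<rbrace>\<^bsub>A\<^esub> else \<zero>\<^bsub>A\<^esub>)"
  proof (cases "n = i + j")
    case True
    have "(\<Oplus>\<^bsub>A\<^esub>l \<in> {..n}. ?f l) = (\<Oplus>\<^bsub>A\<^esub>l \<in> {..n}. if i = l then \<lbrace>a, b\<rbrace>\<^bsub>A\<^esub> else \<zero>\<^bsub>A\<^esub>)"
      using a b True by (auto intro!: M.finsum_cong')
    also have "\<dots> = \<lbrace>a, b\<rbrace>\<^bsub>A\<^esub>"
      using a b True by (intro M.finsum_singleton) auto
    finally show ?thesis using True by simp
  next
    case False
    have "(\<Oplus>\<^bsub>A\<^esub>l \<in> {..n}. ?f l) = (\<Oplus>\<^bsub>A\<^esub>l \<in> {..n}. \<zero>\<^bsub>A\<^esub>)"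
      using a b False by (intro M.finsum_cong') auto
    then show ?thesis using False by simp
  qed
  also have "\<dots> = up_ring.monom (UP A) \<lbrace>a, b\<rbrace>\<^bsub>A\<^esub> (i + j) n"
    using a b by (simp add: UP_def)
  finally show "\<lbrace>up_ring.monom (UP A) a i, up_ring.monom (UP A) b j\<rbrace>\<^bsub>poisson_poly A\<^esub> n
    = up_ring.monom (UP A) \<lbrace>a, b\<rbrace>\<^bsub>A\<^esub> (i + j) n" .
qed

lemma pbracket_variable:
  assumes "a \<in> carrier A"
  shows "\<lbrace>up_ring.monom (UP A) \<one>\<^bsub>A\<^esub> 1, up_ring.monom (UP A) a 0\<rbrace>\<^bsub>poisson_poly A\<^esub> = \<zero>\<^bsub>poisson_poly A\<^esub>"
  using assms pbracket_monom[of "\<one>\<^bsub>A\<^esub>" a 1 0]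
  by (simp add: pbracket_one_left cring.cring_simprules(6)[OF M_cring])
    (auto simp: poisson_poly_def UP_def)

end

end

theory Submission
  imports Defs
begin

text \<open>
  Let \<open>\<phi> : A[t] \<rightarrow> B[s]\<close> be an isomorphism of Poisson algebras and \<open>f = \<phi>(t)\<close>. Dividing by the
  ideals of \<open>t\<close> and of \<open>f\<close> gives \<open>A = A[t]/(t) = B[s]/(f)\<close>, so it suffices to find a Poisson
  central \<open>c \<in> B\<close> such that \<open>f\<close> and \<open>s - c\<close> generate the same ideal: then
  \<open>B[s]/(f) = B[s]/(s - c) = B\<close>, the last step being evaluation at \<open>c\<close>, which preserves
  brackets because \<open>c\<close> is central. Concretely, the isomorphism \<open>A \<rightarrow> B\<close> sends \<open>a\<close> to the value
  of \<open>\<phi>(a)\<close> at \<open>c\<close> (\<open>poisson_cancellation\<close>).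

  Everything about \<open>c\<close> happens in commutative rings. The Poisson center of \<open>A[t]\<close> is \<open>Z[t]\<close> with
  \<open>Z\<close> the Poisson center of \<open>A\<close> (\<open>center_poly\<close>), so \<open>\<phi>\<close> restricts to an isomorphism of
  \<open>Z[t]\<close> onto \<open>W[s]\<close>, where \<open>W\<close> is the Poisson center of \<open>B\<close>, and \<open>f\<close> lies in \<open>W[s]\<close>.

  Whether \<open>Z\<close> is artinian or the image of a field, it is strongly pi-regular: for each \<open>z\<close> some
  power satisfies \<open>z^n = z^(n+1) y\<close>. In a domain such an element is zero or a unit. So let \<open>P\<close> be
  a prime ideal of \<open>W\<close> and reduce coefficients modulo \<open>P\<close>; the image of \<open>Z\<close> in the
  domain \<open>(W/P)[s]\<close> consists of constants. Writing \<open>s = \<phi>(g)\<close> with \<open>g = g_0 + t g'\<close> shows that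
  \<open>f\<close> divides \<open>s\<close> minus a constant modulo \<open>P\<close>, and \<open>f\<close> is not constant there, as otherwise all of
  \<open>(W/P)[s]\<close> would be. Hence \<open>f\<close> has degree exactly one modulo every prime ideal
  (\<open>linear_modulo_primes\<close>): its linear coefficient is a unit of \<open>W\<close> and its higher
  coefficients are nilpotent.

  A polynomial of this shape has the required root (\<open>root_if_linear_modulo_primes\<close>). Up to the ideal
  generated by the nilpotent coefficients, \<open>f\<close> lets one replace \<open>s\<close> by a constant; a Nakayama
  argument removes this error and yields \<open>s = c + f q\<close> with \<open>c \<in> W\<close>. Modulo each prime, degrees
  force \<open>q\<close> to be a nonzero constant, so \<open>q(c)\<close> is a unit, and \<open>f(c) q(c) = 0\<close>
  gives \<open>f(c) = 0\<close>, that is, \<open>s - c\<close> divides \<open>f\<close>.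
\<close>

section \<open>Prime ideals detect units and nilpotents\<close>

text \<open>
  An ideal that is maximal among those containing \<open>I\<close> and disjoint from the multiplicative set
  \<open>S\<close> is prime: each of two elements outside it generates, together with it, an ideal meeting \<open>S\<close>, and if
  their product were in the ideal, so would be the product of the two elements of \<open>S\<close> so found.
\<close>

lemma (in cring) exists_prime_avoiding:
  assumes I: "ideal I R" and S: "S \<subseteq> carrier R" "\<one> \<in> S"
    and S_mult: "\<And>x y. \<lbrakk>x \<in> S; y \<in> S\<rbrakk> \<Longrightarrow> x \<otimes> y \<in> S"
    and disj: "I \<inter> S = {}"
  obtains P where "primeideal P R" "I \<subseteq> P" "P \<inter> S = {}"
proof -
  define F where "F = {J. ideal J R \<and> I \<subseteq> J \<and> J \<inter> S = {}}"
  have "\<exists>M\<in>F. \<forall>J\<in>F. M \<subseteq> J \<longrightarrow> J = M"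
  proof (rule subset_Zorn_nonempty)
    show "F \<noteq> {}" using I disj by (auto simp: F_def)
    fix \<C> assume ne: "\<C> \<noteq> {}" and ch: "subset.chain F \<C>"
    have "subset.chain {J. ideal J R} \<C>"
      using ch by (auto simp: subset_chain_def F_def)
    from chain_Union_is_ideal[OF this] ne have "ideal (\<Union>\<C>) R" by simp
    moreover have "I \<subseteq> \<Union>\<C>" "\<Union>\<C> \<inter> S = {}"
      using ch ne unfolding subset_chain_def F_def by blast+
    ultimately show "\<Union>\<C> \<in> F" by (simp add: F_def)
  qed
  then obtain M where "M \<in> F" and maxF: "\<And>J. \<lbrakk>J \<in> F; M \<subseteq> J\<rbrakk> \<Longrightarrow> J = M" by metis
  then have M: "ideal M R" "I \<subseteq> M" "M \<inter> S = {}" by (auto simp: F_def)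
  have max: "J = M" if "ideal J R" "M \<subseteq> J" "J \<inter> S = {}" for J
    using maxF[of J] that M(2) by (simp add: F_def)
  interpret M: ideal M R by (rule M(1))
  have meets: "\<exists>m\<in>M. \<exists>r\<in>carrier R. m \<oplus> r \<otimes> x \<in> S"
    if x: "x \<in> carrier R" "x \<notin> M" for x
  proof (rule ccontr)
    assume no: "\<not> ?thesis"
    have J: "ideal (M <+> PIdl x) R"
      using add_ideals[OF M(1) cgenideal_ideal[OF x(1)]] .
    have "M \<subseteq> M <+> PIdl x"
    proof
      fix m assume m: "m \<in> M"
      have "m \<oplus> \<zero> \<otimes> x \<in> M <+> PIdl x"
        using m by (auto simp: set_add_def' cgenideal_def)
      with m x show "m \<in> M <+> PIdl x" by simp
    qed
    moreover have "(M <+> PIdl x) \<inter> S = {}"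
      using no by (auto simp: set_add_def' cgenideal_def)
    ultimately have "M <+> PIdl x = M" using max J by blast
    moreover have "\<zero> \<oplus> \<one> \<otimes> x \<in> M <+> PIdl x"
      using M.zero_closed by (force simp: set_add_def' cgenideal_def)
    ultimately show False using x by simp
  qed
  have "primeideal M R"
  proof (rule primeidealI[OF M(1) is_cring])
    show "carrier R \<noteq> M" using M(3) S by blast
    fix a b assume ab: "a \<in> carrier R" "b \<in> carrier R" "a \<otimes> b \<in> M"
    show "a \<in> M \<or> b \<in> M"
    proof (rule ccontr)
      assume "\<not> ?thesis"
      with meets ab obtain m r n s where
        m: "m \<in> M" "r \<in> carrier R" "m \<oplus> r \<otimes> a \<in> S" and
        n: "n \<in> M" "s \<in> carrier R" "n \<oplus> s \<otimes> b \<in> S" by metis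
      have cl: "m \<in> carrier R" "n \<in> carrier R" using m n M.Icarr by auto
      have "(m \<oplus> r \<otimes> a) \<otimes> (n \<oplus> s \<otimes> b)
          = m \<otimes> (n \<oplus> s \<otimes> b) \<oplus> ((r \<otimes> a) \<otimes> n \<oplus> (r \<otimes> s) \<otimes> (a \<otimes> b))"
        using cl m(2) n(2) ab by algebra
      also have "\<dots> \<in> M"
        using cl m(1,2) n(1,2) ab
        by (intro M.a_closed M.I_r_closed[OF m(1)] M.I_l_closed[OF n(1)] M.I_l_closed[OF ab(3)]) auto
      finally show False using S_mult[OF m(3) n(3)] M(3) by blast
    qed
  qed
  with M that show thesis by blast
qed

lemma (in cring) unit_if_in_no_prime:
  assumes x: "x \<in> carrier R" and no: "\<And>P. primeideal P R \<Longrightarrow> x \<notin> P"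
  shows "x \<in> Units R"
proof (rule ccontr)
  assume nu: "x \<notin> Units R"
  have "PIdl x \<inter> {\<one>} = {}"
  proof (rule ccontr)
    assume "\<not> ?thesis"
    then obtain r where "r \<in> carrier R" "\<one> = r \<otimes> x" by (auto simp: cgenideal_def)
    with x have "x \<in> Units R" by (auto simp: Units_def m_comm)
    with nu show False ..
  qed
  then obtain P where "primeideal P R" "PIdl x \<subseteq> P"
    using exists_prime_avoiding[OF cgenideal_ideal[OF x], of "{\<one>}"] by auto
  with no cgenideal_self[OF x] show False by blast
qed

text \<open>
  Avoiding the powers of \<open>x\<close>: if none of them is zero, some prime ideal contains none of them.
\<close>

lemma (in cring) nilpotent_if_in_all_primes:
  assumes x: "x \<in> carrier R" and all: "\<And>P. primeideal P R \<Longrightarrow> x \<in> P"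
  shows "\<exists>n::nat. x [^] n = \<zero>"
proof (rule ccontr)
  let ?S = "range (\<lambda>n::nat. x [^] n)"
  assume "\<not> ?thesis"
  then have disj: "{\<zero>} \<inter> ?S = {}" by auto
  have one: "\<one> \<in> ?S" by (auto intro!: range_eqI[of _ _ 0])
  have mult: "u \<otimes> v \<in> ?S" if "u \<in> ?S" "v \<in> ?S" for u v
    using that x by (auto simp: nat_pow_mult)
  have "?S \<subseteq> carrier R" using x by auto
  then obtain P where P: "primeideal P R" "P \<inter> ?S = {}"
    using exists_prime_avoiding[OF zeroideal _ one mult disj] by metis
  moreover have "x \<in> ?S" using x by (auto intro!: range_eqI[of _ _ 1])
  ultimately show False using all by blast
qed

section \<open>Polynomial rings\<close>

definition poly_C :: "('a, 'm) ring_scheme \<Rightarrow> 'a \<Rightarrow> nat \<Rightarrow> 'a"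
  where "poly_C R a = up_ring.monom (UP R) a 0"

definition poly_X :: "('a, 'm) ring_scheme \<Rightarrow> nat \<Rightarrow> 'a"
  where "poly_X R = up_ring.monom (UP R) \<one>\<^bsub>R\<^esub> 1"

lemma UP_carrier_iff:
  "p \<in> carrier (UP R) \<longleftrightarrow> (\<forall>n. p n \<in> carrier R) \<and> (\<exists>N. \<forall>n>N. p n = \<zero>\<^bsub>R\<^esub>)"
  by (auto simp: UP_def up_def Pi_def bound_def)

context cring
begin

lemma UP_is_cring: "cring (UP R)"
  by (rule UP_cring.UP_cring) (simp add: UP_cring_def is_cring)

lemma UP_coeff_apply: "p \<in> carrier (UP R) \<Longrightarrow> up_ring.coeff (UP R) p n = p n"
  by (simp add: UP_def)

lemma UP_mult_apply:
  "\<lbrakk>p \<in> carrier (UP R); q \<in> carrier (UP R)\<rbrakk>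
    \<Longrightarrow> (p \<otimes>\<^bsub>UP R\<^esub> q) n = (\<Oplus>i \<in> {..n}. p i \<otimes> q (n - i))"
  by (simp add: UP_def)

lemma UP_add_apply:
  "\<lbrakk>p \<in> carrier (UP R); q \<in> carrier (UP R)\<rbrakk> \<Longrightarrow> (p \<oplus>\<^bsub>UP R\<^esub> q) n = p n \<oplus> q n"
  by (simp add: UP_def)

lemma UP_zero_apply: "\<zero>\<^bsub>UP R\<^esub> n = \<zero>"
  by (simp add: UP_def)

lemma UP_one_apply: "\<one>\<^bsub>UP R\<^esub> n = (if n = 0 then \<one> else \<zero>)"
  by (simp add: UP_def)

lemma poly_C_apply: "a \<in> carrier R \<Longrightarrow> poly_C R a n = (if n = 0 then a else \<zero>)"
  by (simp add: UP_def poly_C_def)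

lemma poly_X_apply: "poly_X R n = (if n = 1 then \<one> else \<zero>)"
  by (simp add: UP_def poly_X_def)

lemma poly_C_closed [simp, intro]: "a \<in> carrier R \<Longrightarrow> poly_C R a \<in> carrier (UP R)"
  by (auto simp: UP_carrier_iff poly_C_apply)

lemma poly_X_closed [simp, intro]: "poly_X R \<in> carrier (UP R)"
  by (auto simp: UP_carrier_iff poly_X_apply intro!: exI[of _ 1])

lemma poly_C_hom: "poly_C R \<in> ring_hom R (UP R)"
proof -
  interpret U: UP_cring R "UP R" by (simp_all add: UP_cring_def is_cring)
  show ?thesis unfolding poly_C_def[abs_def] by (rule U.const_ring_hom)
qed

lemma poly_C_mult_apply:
  assumes a: "a \<in> carrier R" and p: "p \<in> carrier (UP R)"
  shows "(poly_C R a \<otimes>\<^bsub>UP R\<^esub> p) n = a \<otimes> p n"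
proof -
  interpret U: UP_cring R "UP R" by (simp_all add: UP_cring_def is_cring)
  have "(poly_C R a \<otimes>\<^bsub>UP R\<^esub> p) n = up_ring.coeff (UP R) (a \<odot>\<^bsub>UP R\<^esub> p) n"
    unfolding poly_C_def U.monom_mult_is_smult[OF a p]
    by (rule UP_coeff_apply[symmetric]) (rule U.UP_smult_closed[OF a p])
  also have "\<dots> = a \<otimes> p n"
    unfolding U.coeff_smult[OF a p] UP_coeff_apply[OF p] ..
  finally show ?thesis .
qed

lemma poly_X_mult_apply:
  assumes p: "p \<in> carrier (UP R)"
  shows "(poly_X R \<otimes>\<^bsub>UP R\<^esub> p) n = (case n of 0 \<Rightarrow> \<zero> | Suc m \<Rightarrow> p m)"
proof (cases n)
  case 0
  moreover have "p 0 \<in> carrier R" using p by (simp add: UP_carrier_iff)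
  ultimately show ?thesis using p by (simp add: UP_mult_apply poly_X_apply)
next
  case (Suc m)
  interpret U: UP_cring R "UP R" by (simp_all add: UP_cring_def is_cring)
  have cl: "poly_X R \<otimes>\<^bsub>UP R\<^esub> p \<in> carrier (UP R)"
    by (rule U.UP_mult_closed[OF poly_X_closed p])
  have "up_ring.coeff (UP R) (poly_X R \<otimes>\<^bsub>UP R\<^esub> p) (m + 1) = \<one> \<otimes> up_ring.coeff (UP R) p m"
    unfolding poly_X_def by (rule U.coeff_monom_mult[OF _ p]) simp
  moreover have "p m \<in> carrier R" using p by (simp add: UP_carrier_iff)
  ultimately show ?thesis unfolding UP_coeff_apply[OF p] UP_coeff_apply[OF cl] using Suc by simp
qed

text \<open>
  Splitting off the constant coefficient, \<open>p = p(0) + X p'\<close>, replaces sums over coefficients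
  in all arguments below; \<open>poly_induct\<close> is the induction it supports.
\<close>

lemma poly_decompose:
  assumes p: "p \<in> carrier (UP R)"
  shows "(\<lambda>n. p (Suc n)) \<in> carrier (UP R)"
    and "p = poly_C R (p 0) \<oplus>\<^bsub>UP R\<^esub> poly_X R \<otimes>\<^bsub>UP R\<^esub> (\<lambda>n. p (Suc n))"
proof -
  from p obtain N where "\<forall>n>N. p n = \<zero>" by (auto simp: UP_carrier_iff)
  with p show s: "(\<lambda>n. p (Suc n)) \<in> carrier (UP R)"
    by (auto simp: UP_carrier_iff intro!: exI[of _ N])
  interpret P: cring "UP R" by (rule UP_is_cring)
  have "p 0 \<in> carrier R" "\<And>n. p n \<in> carrier R" using p by (auto simp: UP_carrier_iff)
  with s show "p = poly_C R (p 0) \<oplus>\<^bsub>UP R\<^esub> poly_X R \<otimes>\<^bsub>UP R\<^esub> (\<lambda>n. p (Suc n))"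
    by (auto simp: fun_eq_iff UP_add_apply poly_C_apply poly_X_mult_apply split: nat.split)
qed

lemma poly_induct [consumes 1, case_names const step]:
  assumes p: "p \<in> carrier (UP R)"
    and const: "\<And>a. a \<in> carrier R \<Longrightarrow> Q (poly_C R a)"
    and step: "\<And>a p. \<lbrakk>a \<in> carrier R; p \<in> carrier (UP R); Q p\<rbrakk>
      \<Longrightarrow> Q (poly_C R a \<oplus>\<^bsub>UP R\<^esub> poly_X R \<otimes>\<^bsub>UP R\<^esub> p)"
  shows "Q p"
proof -
  from p obtain N where "\<forall>n>N. p n = \<zero>" by (auto simp: UP_carrier_iff)
  with p show ?thesis
  proof (induction N arbitrary: p)
    case 0
    then have "p 0 \<in> carrier R" by (auto simp: UP_carrier_iff)
    moreover from this 0 have "p = poly_C R (p 0)" by (auto simp: fun_eq_iff poly_C_apply)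
    ultimately show ?case using const by metis
  next
    case (Suc N)
    have "Q (\<lambda>n. p (Suc n))"
      using Suc.prems by (intro Suc.IH poly_decompose(1)) auto
    moreover have "p 0 \<in> carrier R" using Suc.prems by (auto simp: UP_carrier_iff)
    ultimately show ?case
      using step[OF _ poly_decompose(1)] poly_decompose(2) Suc.prems(1) by metis
  qed
qed

text \<open>
  Applied to the quotient map by a prime ideal, this is reduction of coefficients; applied to the
  inclusion of a subring, it says that the polynomial ring over the subring sits inside \<open>R[X]\<close>.
\<close>

lemma UP_hom_map:
  assumes S: "cring S" and h: "h \<in> ring_hom R S"
  shows "(\<lambda>p n. h (p n)) \<in> ring_hom (UP R) (UP S)"
proof -
  interpret S: cring S by (rule S)
  interpret h: ring_hom_cring R S h
    by (rule ring_hom_cringI[OF is_cring S h])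
  have cl: "(\<lambda>n. h (p n)) \<in> carrier (UP S)" if "p \<in> carrier (UP R)" for p
  proof -
    from that obtain N where "\<forall>n>N. p n = \<zero>" by (auto simp: UP_carrier_iff)
    with that show ?thesis by (auto simp: UP_carrier_iff intro!: exI[of _ N])
  qed
  show ?thesis
  proof (rule ring_hom_memI)
    fix p q assume p: "p \<in> carrier (UP R)" and q: "q \<in> carrier (UP R)"
    have pq: "\<And>n. p n \<in> carrier R" "\<And>n. q n \<in> carrier R"
      using p q by (auto simp: UP_carrier_iff)
    show "(\<lambda>n. h ((p \<otimes>\<^bsub>UP R\<^esub> q) n)) = (\<lambda>n. h (p n)) \<otimes>\<^bsub>UP S\<^esub> (\<lambda>n. h (q n))"
      using pq by (auto simp: fun_eq_iff UP_mult_apply[OF p q] S.UP_mult_apply[OF cl[OF p] cl[OF q]]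
          Pi_def intro!: S.finsum_cong')
    show "(\<lambda>n. h ((p \<oplus>\<^bsub>UP R\<^esub> q) n)) = (\<lambda>n. h (p n)) \<oplus>\<^bsub>UP S\<^esub> (\<lambda>n. h (q n))"
      using pq by (auto simp: fun_eq_iff UP_add_apply[OF p q] S.UP_add_apply[OF cl[OF p] cl[OF q]])
  qed (auto simp: cl fun_eq_iff UP_one_apply S.UP_one_apply)
qed

lemma evaluation_hom:
  assumes c: "c \<in> carrier R"
  obtains e where "e \<in> ring_hom (UP R) R" "\<And>a. a \<in> carrier R \<Longrightarrow> e (poly_C R a) = a" "e (poly_X R) = c"
proof -
  interpret U: UP_pre_univ_prop R R id "UP R"
    by (intro UP_pre_univ_propI is_cring) (auto simp: ring_hom_def)
  show thesis
    using that[of "UnivPoly.eval R R id c"] U.eval_ring_hom[OF c] U.eval_const[OF c] U.eval_monom1[OF c]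
    by (simp add: poly_C_def poly_X_def)
qed

text \<open>
  One step of division by \<open>x - c\<close>: if \<open>d\<close> is the remainder for \<open>p\<close>, then \<open>a + c d\<close> is
  the remainder for \<open>a + x p\<close>.
\<close>

lemma horner_step:
  assumes "a \<in> carrier R" "x \<in> carrier R" "c \<in> carrier R" "q \<in> carrier R" "d \<in> carrier R"
  shows "a \<oplus> x \<otimes> ((x \<ominus> c) \<otimes> q \<oplus> d) = (x \<ominus> c) \<otimes> (x \<otimes> q \<oplus> d) \<oplus> (a \<oplus> c \<otimes> d)"
  using assms by algebra

text \<open>
  Horner's scheme: the remainder and the quotient are built up together by induction on \<open>p\<close>.
\<close>

lemma factor_theorem:
  assumes c: "c \<in> carrier R" and e: "e \<in> ring_hom (UP R) R"
    and eC: "\<And>a. a \<in> carrier R \<Longrightarrow> e (poly_C R a) = a" and eX: "e (poly_X R) = c"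
    and p: "p \<in> carrier (UP R)"
  shows "\<exists>q \<in> carrier (UP R). p = (poly_X R \<ominus>\<^bsub>UP R\<^esub> poly_C R c) \<otimes>\<^bsub>UP R\<^esub> q \<oplus>\<^bsub>UP R\<^esub> poly_C R (e p)"
  using p
proof (induction rule: poly_induct)
  interpret P: cring "UP R" by (rule UP_is_cring)
  interpret e: ring_hom_cring "UP R" R e by (rule ring_hom_cringI[OF UP_is_cring is_cring e])
  interpret C: ring_hom_cring R "UP R" "poly_C R"
    by (rule ring_hom_cringI[OF is_cring UP_is_cring poly_C_hom])
  {
    case (const a)
    then show ?case using c by (intro bexI[of _ "\<zero>\<^bsub>UP R\<^esub>"]) (auto simp: eC)
  next
    case (step a p)
    then obtain q where q: "q \<in> carrier (UP R)"
      "p = (poly_X R \<ominus>\<^bsub>UP R\<^esub> poly_C R c) \<otimes>\<^bsub>UP R\<^esub> q \<oplus>\<^bsub>UP R\<^esub> poly_C R (e p)" by auto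
    let ?X = "poly_X R" and ?c = "poly_C R c"
    have ep: "e (poly_C R a \<oplus>\<^bsub>UP R\<^esub> ?X \<otimes>\<^bsub>UP R\<^esub> p) = a \<oplus> c \<otimes> e p"
      using step c by (simp add: eC eX)
    have "poly_C R a \<oplus>\<^bsub>UP R\<^esub> ?X \<otimes>\<^bsub>UP R\<^esub> p = poly_C R a \<oplus>\<^bsub>UP R\<^esub> ?X \<otimes>\<^bsub>UP R\<^esub>
      ((?X \<ominus>\<^bsub>UP R\<^esub> ?c) \<otimes>\<^bsub>UP R\<^esub> q \<oplus>\<^bsub>UP R\<^esub> poly_C R (e p))" using q(2) by simp
    also have "\<dots> = (?X \<ominus>\<^bsub>UP R\<^esub> ?c) \<otimes>\<^bsub>UP R\<^esub> (?X \<otimes>\<^bsub>UP R\<^esub> q \<oplus>\<^bsub>UP R\<^esub> poly_C R (e p))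
       \<oplus>\<^bsub>UP R\<^esub> (poly_C R a \<oplus>\<^bsub>UP R\<^esub> ?c \<otimes>\<^bsub>UP R\<^esub> poly_C R (e p))"
      using step c q(1) by (intro P.horner_step) auto
    finally show ?case
      using ep q(1) step c
      by (intro bexI[of _ "?X \<otimes>\<^bsub>UP R\<^esub> q \<oplus>\<^bsub>UP R\<^esub> poly_C R (e p)"]) (simp_all add: e.hom_closed)
  }
qed

end

section \<open>Degrees over a domain\<close>

lemma (in domain) deg_poly_X: "deg R (poly_X R) = 1"
  unfolding poly_X_def by (rule UP_ring.deg_monom) (simp_all add: UP_ring_def local.ring_axioms)

lemma (in cring) deg_eq_1_iff:
  assumes p: "p \<in> carrier (UP R)"
  shows "deg R p = 1 \<longleftrightarrow> p 1 \<noteq> \<zero> \<and> (\<forall>i\<ge>2. p i = \<zero>)"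
proof -
  have U: "UP_ring R" by (simp add: UP_ring_def local.ring_axioms)
  show ?thesis
  proof
    assume d: "deg R p = 1"
    have "p 1 \<noteq> \<zero>"
      using UP_ring.lcoeff_nonzero_deg[OF U _ p] d UP_coeff_apply[OF p] by simp
    moreover have "p i = \<zero>" if "i \<ge> 2" for i
      using UP_ring.deg_aboveD[OF U _ p, of i] that d UP_coeff_apply[OF p] by simp
    ultimately show "p 1 \<noteq> \<zero> \<and> (\<forall>i\<ge>2. p i = \<zero>)" by blast
  next
    assume "p 1 \<noteq> \<zero> \<and> (\<forall>i\<ge>2. p i = \<zero>)"
    then have "deg R p \<le> 1" "1 \<le> deg R p"
      by (auto intro!: UP_ring.deg_aboveI[OF U _ p] UP_ring.deg_belowI[OF U _ p]
          simp: UP_coeff_apply[OF p])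
    then show "deg R p = 1" by simp
  qed
qed

lemma (in domain) UP_is_domain: "domain (UP R)"
  by (rule UP_domain.UP_domain) (simp add: UP_domain_def domain_axioms)

lemma (in domain) deg_UP_mult:
  "\<lbrakk>p \<in> carrier (UP R); q \<in> carrier (UP R); p \<noteq> \<zero>\<^bsub>UP R\<^esub>; q \<noteq> \<zero>\<^bsub>UP R\<^esub>\<rbrakk>
    \<Longrightarrow> deg R (p \<otimes>\<^bsub>UP R\<^esub> q) = deg R p + deg R q"
  by (rule UP_domain.deg_mult) (simp_all add: UP_domain_def domain_axioms)

lemma (in cring) deg_minus_const_le:
  assumes p: "p \<in> carrier (UP R)" and q: "q \<in> carrier (UP R)" "deg R q = 0"
  shows "deg R (p \<ominus>\<^bsub>UP R\<^esub> q) \<le> deg R p"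
proof -
  have U: "UP_ring R" by (simp add: UP_ring_def local.ring_axioms)
  interpret P: cring "UP R" by (rule UP_is_cring)
  show ?thesis
    using UP_ring.deg_add[OF U p P.a_inv_closed[OF q(1)]] UP_ring.deg_uminus[OF U q(1)] q(2)
    by (simp add: P.minus_eq)
qed

lemma (in domain) deg_poly_X_minus_C:
  assumes "c \<in> carrier R"
  shows "deg R (poly_X R \<ominus>\<^bsub>UP R\<^esub> poly_C R c) = 1"
proof -
  have "carrier R \<noteq> {\<zero>}" using one_closed one_not_zero by blast
  then show ?thesis unfolding poly_X_def poly_C_def
    by (intro UP_cring.deg_minus_monom[OF _ assms]) (simp_all add: UP_cring_def is_cring)
qed

section \<open>Strongly pi-regular rings\<close>

text \<open>
  This is the form in which zero-dimensionality of the Poisson center is used: for commutative rings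
  it says that all prime ideals are maximal, and it passes to homomorphic images.
\<close>

definition strongly_pi_regular :: "('a, 'm) ring_scheme \<Rightarrow> bool"
  where "strongly_pi_regular R \<longleftrightarrow>
    (\<forall>x \<in> carrier R. \<exists>n::nat. \<exists>y \<in> carrier R. x [^]\<^bsub>R\<^esub> n = x [^]\<^bsub>R\<^esub> Suc n \<otimes>\<^bsub>R\<^esub> y)"

text \<open>
  The descending chain of principal ideals generated by the powers of \<open>x\<close> becomes stationary.
\<close>

lemma artinian_imp_strongly_pi_regular:
  assumes "artinian_ring R" and "cring R"
  shows "strongly_pi_regular R"
  unfolding strongly_pi_regular_def
proof
  interpret cring R by fact
  interpret artinian_ring R by fact
  fix x assume x: "x \<in> carrier R"
  have ideals: "ideal (PIdl\<^bsub>R\<^esub> (x [^]\<^bsub>R\<^esub> n)) R" for n :: nat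
    using x by (intro cgenideal_ideal) simp
  have "decseq (\<lambda>n. PIdl\<^bsub>R\<^esub> (x [^]\<^bsub>R\<^esub> n))"
    unfolding decseq_Suc_iff
  proof
    fix n show "PIdl\<^bsub>R\<^esub> (x [^]\<^bsub>R\<^esub> Suc n) \<subseteq> PIdl\<^bsub>R\<^esub> (x [^]\<^bsub>R\<^esub> n)"
    proof (rule cgenideal_minimal[OF cgenideal_ideal])
      have "x \<otimes>\<^bsub>R\<^esub> x [^]\<^bsub>R\<^esub> n \<in> PIdl\<^bsub>R\<^esub> (x [^]\<^bsub>R\<^esub> n)"
        using x by (auto simp: cgenideal_def)
      with x show "x [^]\<^bsub>R\<^esub> Suc n \<in> PIdl\<^bsub>R\<^esub> (x [^]\<^bsub>R\<^esub> n)" by (simp add: m_comm)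
    qed (use x in simp)
  qed
  from descending_chain[OF ideals this] obtain N :: nat where "\<forall>n\<ge>N. PIdl\<^bsub>R\<^esub> (x [^]\<^bsub>R\<^esub> n) = PIdl\<^bsub>R\<^esub> (x [^]\<^bsub>R\<^esub> N)" ..
  then have "PIdl\<^bsub>R\<^esub> (x [^]\<^bsub>R\<^esub> Suc N) = PIdl\<^bsub>R\<^esub> (x [^]\<^bsub>R\<^esub> N)" by (meson le_Suc_eq order_refl)
  moreover have "x [^]\<^bsub>R\<^esub> N \<in> PIdl\<^bsub>R\<^esub> (x [^]\<^bsub>R\<^esub> N)"
    using x by (intro cgenideal_self) simp
  ultimately obtain y where "y \<in> carrier R" "x [^]\<^bsub>R\<^esub> N = y \<otimes>\<^bsub>R\<^esub> x [^]\<^bsub>R\<^esub> Suc N"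
    by (auto simp: cgenideal_def)
  then show "\<exists>n::nat. \<exists>y \<in> carrier R. x [^]\<^bsub>R\<^esub> n = x [^]\<^bsub>R\<^esub> Suc n \<otimes>\<^bsub>R\<^esub> y"
    using x by (metis m_comm nat_pow_closed)
qed

lemma (in domain) pi_regular_element_cases:
  assumes x: "x \<in> carrier R" and y: "y \<in> carrier R" and eq: "x [^] (n::nat) = x [^] Suc n \<otimes> y"
  shows "x = \<zero> \<or> x \<otimes> y = \<one>"
proof (cases "x = \<zero>")
  case False
  have "x [^] n \<noteq> \<zero>" using False x by (induction n) (auto simp: integral_iff)
  moreover have "x [^] n \<otimes> (x \<otimes> y) = x [^] n \<otimes> \<one>" using eq x y by (simp add: m_assoc)
  ultimately have "x \<otimes> y = \<one>"
    using m_lcancel[of "x [^] n" "x \<otimes> y" \<one>] x y by simp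
  then show ?thesis by simp
qed simp

text \<open>
  In the domain \<open>R[X]\<close> the hypothesis leaves only zero and units, and units have degree zero.
\<close>

lemma (in domain) deg_zero_if_pi_regular:
  assumes p: "p \<in> carrier (UP R)" and q: "q \<in> carrier (UP R)"
    and eq: "p [^]\<^bsub>UP R\<^esub> (n::nat) = p [^]\<^bsub>UP R\<^esub> Suc n \<otimes>\<^bsub>UP R\<^esub> q"
  shows "deg R p = 0"
proof -
  interpret P: "domain" "UP R" by (rule UP_is_domain)
  have U: "UP_ring R" by (simp add: UP_ring_def local.ring_axioms)
  have d1: "deg R \<one>\<^bsub>UP R\<^esub> = 0" by (rule UP_ring.deg_one[OF U])
  have d0: "deg R \<zero>\<^bsub>UP R\<^esub> = 0" by (rule UP_ring.deg_zero[OF U])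
  from P.pi_regular_element_cases[OF p q eq] show ?thesis
  proof
    assume pq: "p \<otimes>\<^bsub>UP R\<^esub> q = \<one>\<^bsub>UP R\<^esub>"
    with p q have "p \<noteq> \<zero>\<^bsub>UP R\<^esub>" "q \<noteq> \<zero>\<^bsub>UP R\<^esub>" by auto
    with deg_UP_mult[OF p q] pq d1 show ?thesis by simp
  qed (simp add: d0)
qed

lemma (in cring) add_minus_cancel:
  "\<lbrakk>a \<in> carrier R; b \<in> carrier R\<rbrakk> \<Longrightarrow> b = (a \<oplus> b) \<ominus> a"
  by algebra

text \<open>
  The coefficients from \<open>Z\<close> map to constants, so all of the freedom is in the image \<open>u\<close> of
  the variable. If \<open>u\<close> were constant, the whole image would be, but it contains \<open>X\<close>. On
  the other hand \<open>X = \<psi>(g_0) + u \<psi>(g')\<close> makes \<open>u\<close> a divisor of a polynomial of degree one.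
\<close>

lemma deg_of_generator_image:
  assumes Z: "cring Z" "strongly_pi_regular Z" and D: "domain D"
    and \<psi>: "\<psi> \<in> ring_hom (UP Z) (UP D)"
    and g: "g \<in> carrier (UP Z)" "\<psi> g = poly_X D"
  shows "deg D (\<psi> (poly_X Z)) = 1"
proof -
  interpret Z: cring Z by (rule Z(1))
  interpret D: "domain" D by (rule D)
  interpret PD: "domain" "UP D" by (rule D.UP_is_domain)
  interpret \<psi>: ring_hom_cring "UP Z" "UP D" \<psi>
    by (rule ring_hom_cringI[OF Z.UP_is_cring PD.is_cring \<psi>])
  interpret C: ring_hom_cring Z "UP Z" "poly_C Z"
    by (rule ring_hom_cringI[OF Z.is_cring Z.UP_is_cring Z.poly_C_hom])
  have U: "UP_ring D" by (simp add: UP_ring_def D.ring_axioms)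
  let ?t = "\<psi> (poly_X Z)"
  have t: "?t \<in> carrier (UP D)" by (rule \<psi>.hom_closed[OF Z.poly_X_closed])
  have const: "deg D (\<psi> (poly_C Z a)) = 0" if a: "a \<in> carrier Z" for a
  proof -
    from Z(2) a obtain n :: nat and y where y: "y \<in> carrier Z"
      and eq: "a [^]\<^bsub>Z\<^esub> n = a [^]\<^bsub>Z\<^esub> Suc n \<otimes>\<^bsub>Z\<^esub> y"
      unfolding strongly_pi_regular_def by blast
    have cl: "poly_C Z a \<in> carrier (UP Z)" "poly_C Z y \<in> carrier (UP Z)"
      using a y by (auto intro: Z.poly_C_closed)
    have "\<psi> (poly_C Z (a [^]\<^bsub>Z\<^esub> n)) = \<psi> (poly_C Z (a [^]\<^bsub>Z\<^esub> Suc n \<otimes>\<^bsub>Z\<^esub> y))" using eq by simp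
    then have "\<psi> (poly_C Z a) [^]\<^bsub>UP D\<^esub> n
        = \<psi> (poly_C Z a) [^]\<^bsub>UP D\<^esub> Suc n \<otimes>\<^bsub>UP D\<^esub> \<psi> (poly_C Z y)"
      using a y cl by (simp del: nat_pow_Suc)
    then show ?thesis
      using cl by (intro D.deg_zero_if_pi_regular[of _ "\<psi> (poly_C Z y)" n]) simp_all
  qed
  have "deg D ?t \<noteq> 0"
  proof
    assume dt: "deg D ?t = 0"
    have "deg D (\<psi> p) = 0" if "p \<in> carrier (UP Z)" for p
      using that
    proof (induction rule: Z.poly_induct)
      case (const a)
      then show ?case using \<open>\<And>a. a \<in> carrier Z \<Longrightarrow> deg D (\<psi> (poly_C Z a)) = 0\<close> by simp
    next
      case (step a p)
      have c: "\<psi> (poly_C Z a) \<in> carrier (UP D)" "\<psi> p \<in> carrier (UP D)"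
        using step by (auto intro: Z.poly_C_closed)
      have "deg D (?t \<otimes>\<^bsub>UP D\<^esub> \<psi> p) \<le> 0"
        using UP_ring.deg_mult_ring[OF U t c(2)] dt step.IH by simp
      then have "deg D (\<psi> (poly_C Z a) \<oplus>\<^bsub>UP D\<^esub> ?t \<otimes>\<^bsub>UP D\<^esub> \<psi> p) = 0"
        using UP_ring.deg_add[OF U c(1) PD.m_closed[OF t c(2)]] const[OF step(1)] by simp
      then show ?case
        using step(1,2) by (simp add: Z.poly_C_closed Z.poly_X_closed)
    qed
    from this[OF g(1)] g(2) D.deg_poly_X show False by simp
  qed
  moreover have "deg D ?t \<le> 1"
  proof -
    let ?g = "\<lambda>n. g (Suc n)"
    have g0: "g 0 \<in> carrier Z" using g(1) by (simp add: UP_carrier_iff)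
    have s: "\<psi> ?g \<in> carrier (UP D)" by (rule \<psi>.hom_closed[OF Z.poly_decompose(1)[OF g(1)]])
    have c: "\<psi> (poly_C Z (g 0)) \<in> carrier (UP D)"
      by (rule \<psi>.hom_closed[OF Z.poly_C_closed[OF g0]])
    have "poly_X D = \<psi> (poly_C Z (g 0) \<oplus>\<^bsub>UP Z\<^esub> poly_X Z \<otimes>\<^bsub>UP Z\<^esub> ?g)"
      using g Z.poly_decompose(2)[OF g(1)] by simp
    also have "\<dots> = \<psi> (poly_C Z (g 0)) \<oplus>\<^bsub>UP D\<^esub> ?t \<otimes>\<^bsub>UP D\<^esub> \<psi> ?g"
      using g0 Z.poly_decompose(1)[OF g(1)] by (simp add: Z.poly_C_closed Z.poly_X_closed)
    finally have X: "poly_X D = \<psi> (poly_C Z (g 0)) \<oplus>\<^bsub>UP D\<^esub> ?t \<otimes>\<^bsub>UP D\<^esub> \<psi> ?g" .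
    have nz: "?t \<noteq> \<zero>\<^bsub>UP D\<^esub>" "\<psi> ?g \<noteq> \<zero>\<^bsub>UP D\<^esub>"
      using X const[OF g0] D.deg_poly_X s t c by auto
    have "?t \<otimes>\<^bsub>UP D\<^esub> \<psi> ?g = poly_X D \<ominus>\<^bsub>UP D\<^esub> \<psi> (poly_C Z (g 0))"
      unfolding X by (rule PD.add_minus_cancel[OF c PD.m_closed[OF t s]])
    then have "deg D (?t \<otimes>\<^bsub>UP D\<^esub> \<psi> ?g) \<le> 1"
      using D.deg_minus_const_le[OF D.poly_X_closed c const[OF g0]] D.deg_poly_X by simp
    then show ?thesis using D.deg_UP_mult[OF t s nz] by simp
  qed
  ultimately show ?thesis by simp
qed

lemma (in ideal) coset_eq_zero_iff:
  assumes "x \<in> carrier R"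
  shows "I +> x = \<zero>\<^bsub>R Quot I\<^esub> \<longleftrightarrow> x \<in> I"
  using assms a_rcos_zero[OF is_ideal] rcos_const_imp_mem by (auto simp: FactRing_def)

text \<open>
  This is \<open>deg_of_generator_image\<close> for the composite of \<open>\<phi>\<close> with reduction of coefficients modulo \<open>P\<close>.
\<close>

lemma linear_modulo_primes:
  assumes Z: "cring Z" "strongly_pi_regular Z" and W: "cring W"
    and \<phi>: "\<phi> \<in> ring_hom (UP Z) (UP W)"
    and g: "g \<in> carrier (UP Z)" "\<phi> g = poly_X W"
    and P: "primeideal P W"
  shows "\<phi> (poly_X Z) 1 \<notin> P" and "i \<ge> 2 \<Longrightarrow> \<phi> (poly_X Z) i \<in> P"
proof -
  interpret Z: cring Z by (rule Z(1))
  interpret W: cring W by (rule W)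
  interpret P: primeideal P W by (rule P)
  let ?D = "W Quot P" and ?h = "\<lambda>x. P +>\<^bsub>W\<^esub> x"
  interpret D: "domain" ?D by (rule P.quotient_is_domain)
  have h: "?h \<in> ring_hom W ?D" by (rule P.rcos_ring_hom)
  have hom: "(\<lambda>p n. ?h (p n)) \<circ> \<phi> \<in> ring_hom (UP Z) (UP ?D)"
    using ring_hom_trans[OF \<phi> W.UP_hom_map[OF D.is_cring h]] .
  have "?h (poly_X W n) = poly_X ?D n" for n
    using ring_hom_one[OF h] ring_hom_zero[OF h W.ring_axioms D.ring_axioms]
    by (simp add: W.poly_X_apply D.poly_X_apply)
  then have "deg ?D (((\<lambda>p n. ?h (p n)) \<circ> \<phi>) (poly_X Z)) = 1"
    using g by (intro deg_of_generator_image[OF Z P.quotient_is_domain hom g(1)]) auto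
  moreover have f: "\<phi> (poly_X Z) \<in> carrier (UP W)"
    using ring_hom_closed[OF \<phi> Z.poly_X_closed] .
  moreover have "((\<lambda>p n. ?h (p n)) \<circ> \<phi>) (poly_X Z) \<in> carrier (UP ?D)"
    using ring_hom_closed[OF hom Z.poly_X_closed] .
  ultimately have "?h (\<phi> (poly_X Z) 1) \<noteq> \<zero>\<^bsub>?D\<^esub> \<and> (\<forall>i\<ge>2. ?h (\<phi> (poly_X Z) i) = \<zero>\<^bsub>?D\<^esub>)"
    using D.deg_eq_1_iff by simp
  moreover have "\<phi> (poly_X Z) i \<in> carrier W" for i using f by (simp add: UP_carrier_iff)
  ultimately show "\<phi> (poly_X Z) 1 \<notin> P" and "i \<ge> 2 \<Longrightarrow> \<phi> (poly_X Z) i \<in> P"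
    using P.coset_eq_zero_iff by blast+
qed

section \<open>A root of a polynomial that is linear up to nilpotents\<close>

text \<open>
  The combinatorial core of Nakayama's lemma for an ideal \<open>I\<close> and finitely many nilpotent elements.
  If \<open>\<one>\<close> were not in \<open>I\<close>, some monomial in the \<open>f i\<close> outside \<open>I\<close> would be maximal, in that
  each further factor \<open>f i\<close> moves it into \<open>I\<close>; the last hypothesis forbids this. Formally, the
  hypothesis that \<open>f i \<otimes> x\<close> lies in \<open>I\<close> is discharged for one index \<open>i\<close> after another.
\<close>

lemma (in cring) absorb_nilpotent_family:
  fixes f :: "'i \<Rightarrow> 'a"
  assumes F: "finite F" and f: "\<And>i. f i \<in> carrier R" and nil: "\<And>i. i \<in> F \<Longrightarrow> \<exists>n::nat. f i [^] n = \<zero>"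
    and zero: "\<zero> \<in> I" and mult: "\<And>a x. \<lbrakk>a \<in> carrier R; x \<in> carrier R; x \<in> I\<rbrakk> \<Longrightarrow> a \<otimes> x \<in> I"
    and absorb: "\<And>x. \<lbrakk>x \<in> carrier R; \<And>i. i \<in> F \<Longrightarrow> f i \<otimes> x \<in> I\<rbrakk> \<Longrightarrow> x \<in> I"
  shows "\<one> \<in> I"
proof -
  have "x \<in> I" if "G \<subseteq> F" "x \<in> carrier R" "\<And>i. i \<in> F - G \<Longrightarrow> f i \<otimes> x \<in> I" for G x
    using finite_subset[OF that(1) F] that
  proof (induction G arbitrary: x rule: finite_induct)
    case empty
    then show ?case using absorb by simp
  next
    case (insert j G)
    from insert.prems nil obtain N :: nat where N: "f j [^] N = \<zero>" by blast
    \<comment> \<open>descending induction on the exponent, starting from \<open>f j [^] N = \<zero>\<close>\<close>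
    have "f j [^] (N - k) \<otimes> x \<in> I" for k
    proof (induction k)
      case 0
      then show ?case using N zero insert.prems by simp
    next
      case (Suc k)
      let ?y = "f j [^] (N - Suc k) \<otimes> x"
      show ?case
      proof (cases "k < N")
        case True
        then have "N - k = Suc (N - Suc k)" by simp
        with Suc.IH have j: "f j \<otimes> ?y \<in> I"
          using insert.prems(2) f[of j] by (simp add: m_ac)
        have "f i \<otimes> ?y \<in> I" if "i \<in> F - insert j G" for i
        proof -
          have "f j [^] (N - Suc k) \<otimes> (f i \<otimes> x) \<in> I"
            using insert.prems that f by (intro mult[of _ "f i \<otimes> x"]) auto
          then show ?thesis using insert.prems(2) f by (simp add: m_lcomm)
        qed
        with j have "\<And>i. i \<in> F - G \<Longrightarrow> f i \<otimes> ?y \<in> I" by blast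
        with insert.prems insert.IH[of ?y] f show ?thesis by auto
      next
        case False
        with Suc.IH show ?thesis by simp
      qed
    qed
    from this[of N] show ?case using insert.prems(2) by simp
  qed
  from this[of F \<one>] show ?thesis by simp
qed

text \<open>
  The identity obtained by solving \<open>F = f0 + t f1 + t^2 r\<close> for \<open>t\<close>, when \<open>f1\<close> has inverse \<open>u\<close>:
  \<open>t = u F - u f0 - u r t^2\<close>, multiplied by \<open>x g\<close>.
\<close>

lemma (in cring) horner_solve:
  assumes "f0 \<in> carrier R" "f1 \<in> carrier R" "u \<in> carrier R" "t \<in> carrier R" "r \<in> carrier R"
    "x \<in> carrier R" "g \<in> carrier R" and u: "u \<otimes> f1 = \<one>"
  shows "x \<otimes> (t \<otimes> g) = u \<otimes> ((f0 \<oplus> t \<otimes> (f1 \<oplus> t \<otimes> r)) \<otimes> (x \<otimes> g))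
      \<oplus> ((\<ominus> (u \<otimes> f0)) \<otimes> (x \<otimes> g) \<oplus> (\<ominus> u) \<otimes> (x \<otimes> (r \<otimes> (t \<otimes> (t \<otimes> g)))))"
proof -
  have "x \<otimes> (t \<otimes> g) = (u \<otimes> f1) \<otimes> (x \<otimes> (t \<otimes> g))" using assms by simp
  also have "\<dots> = u \<otimes> ((f0 \<oplus> t \<otimes> (f1 \<oplus> t \<otimes> r)) \<otimes> (x \<otimes> g))
      \<oplus> ((\<ominus> (u \<otimes> f0)) \<otimes> (x \<otimes> g) \<oplus> (\<ominus> u) \<otimes> (x \<otimes> (r \<otimes> (t \<otimes> (t \<otimes> g)))))"
    using assms(1-7) by algebra
  finally show ?thesis .
qed

text \<open>
  Let \<open>M\<close> consist of the polynomials congruent to a constant modulo \<open>f\<close>, an \<open>R\<close>-submodule of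
  \<open>R[X]\<close>, and let \<open>I\<close> be the ideal of all \<open>x \<in> R\<close> with \<open>x R[X] \<subseteq> M\<close>. Suppose \<open>f i \<otimes> x \<in> I\<close>
  for all \<open>i \<ge> 2\<close>. After multiplication by \<open>x\<close>, the terms of \<open>f\<close> of degree at least two
  then contribute only elements of \<open>M\<close>, so the invertible linear coefficient allows each factor
  \<open>X\<close> to be traded for a constant; this gives \<open>x \<in> I\<close>. As the higher coefficients
  are nilpotent, \<open>absorb_nilpotent_family\<close> yields \<open>\<one> \<in> I\<close>, and in particular \<open>X \<in> M\<close>.
\<close>

lemma (in cring) variable_congruent_to_constant:
  assumes f: "f \<in> carrier (UP R)" and unit: "f 1 \<in> Units R"
    and nil: "\<And>i. i \<ge> 2 \<Longrightarrow> \<exists>n::nat. f i [^] n = \<zero>"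
  shows "\<exists>c \<in> carrier R. \<exists>q \<in> carrier (UP R). poly_X R = poly_C R c \<oplus>\<^bsub>UP R\<^esub> f \<otimes>\<^bsub>UP R\<^esub> q"
proof -
  interpret P: cring "UP R" by (rule UP_is_cring)
  interpret C: ring_hom_cring R "UP R" "poly_C R"
    by (rule ring_hom_cringI[OF is_cring UP_is_cring poly_C_hom])
  define M where "M = {poly_C R w \<oplus>\<^bsub>UP R\<^esub> f \<otimes>\<^bsub>UP R\<^esub> q | w q. w \<in> carrier R \<and> q \<in> carrier (UP R)}"
  have M_const: "poly_C R a \<in> M" if "a \<in> carrier R" for a
    using that f by (auto simp: M_def intro!: exI[of _ a] exI[of _ "\<zero>\<^bsub>UP R\<^esub>"])
  have M_f: "f \<otimes>\<^bsub>UP R\<^esub> q \<in> M" if "q \<in> carrier (UP R)" for q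
    using that f by (auto simp: M_def intro!: exI[of _ \<zero>] exI[of _ q])
  have M_add: "g \<oplus>\<^bsub>UP R\<^esub> h \<in> M" if gh: "g \<in> M" "h \<in> M" for g h
  proof -
    from gh obtain v p w q where cl: "v \<in> carrier R" "w \<in> carrier R" "p \<in> carrier (UP R)" "q \<in> carrier (UP R)"
      and eq: "g = poly_C R v \<oplus>\<^bsub>UP R\<^esub> f \<otimes>\<^bsub>UP R\<^esub> p" "h = poly_C R w \<oplus>\<^bsub>UP R\<^esub> f \<otimes>\<^bsub>UP R\<^esub> q"
      by (auto simp: M_def)
    have "g \<oplus>\<^bsub>UP R\<^esub> h = poly_C R (v \<oplus> w) \<oplus>\<^bsub>UP R\<^esub> f \<otimes>\<^bsub>UP R\<^esub> (p \<oplus>\<^bsub>UP R\<^esub> q)"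
      using cl f by (simp add: eq P.r_distr P.a_ac)
    with cl show ?thesis unfolding M_def by blast
  qed
  have M_smult: "poly_C R a \<otimes>\<^bsub>UP R\<^esub> g \<in> M" if a: "a \<in> carrier R" and g: "g \<in> M" for a g
  proof -
    from g obtain w q where cl: "w \<in> carrier R" "q \<in> carrier (UP R)"
      and eq: "g = poly_C R w \<oplus>\<^bsub>UP R\<^esub> f \<otimes>\<^bsub>UP R\<^esub> q" by (auto simp: M_def)
    have "poly_C R a \<otimes>\<^bsub>UP R\<^esub> g = poly_C R (a \<otimes> w) \<oplus>\<^bsub>UP R\<^esub> f \<otimes>\<^bsub>UP R\<^esub> (poly_C R a \<otimes>\<^bsub>UP R\<^esub> q)"
      using cl f a by (simp add: eq P.r_distr P.m_lcomm)
    with cl a show ?thesis unfolding M_def by blast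
  qed
  define I where "I = {x \<in> carrier R. \<forall>g \<in> carrier (UP R). poly_C R x \<otimes>\<^bsub>UP R\<^esub> g \<in> M}"
  have I_mult: "a \<otimes> x \<in> I" if "a \<in> carrier R" "x \<in> I" for a x
    using that M_smult by (auto simp: I_def P.m_assoc)
  have zero_I: "\<zero> \<in> I"
    using M_const[of \<zero>] by (simp add: I_def)
  have f_cl: "f i \<in> carrier R" for i using f by (simp add: UP_carrier_iff)
  \<comment> \<open>the product is a sum of terms \<open>(p i \<otimes> x) X^i g\<close>, each in \<open>M\<close> because \<open>p i \<otimes> x\<close> is in \<open>I\<close>\<close>
  have poly_absorb: "poly_C R x \<otimes>\<^bsub>UP R\<^esub> (p \<otimes>\<^bsub>UP R\<^esub> g) \<in> M"
    if "x \<in> carrier R" "p \<in> carrier (UP R)" "\<And>i. p i \<otimes> x \<in> I" "g \<in> carrier (UP R)" for x p g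
    using that(2,3,4)
  proof (induction arbitrary: g rule: poly_induct)
    case (const a)
    have "a \<otimes> x \<in> I" using const.prems(1)[of 0] const.hyps by (simp add: poly_C_apply)
    then have "poly_C R (a \<otimes> x) \<otimes>\<^bsub>UP R\<^esub> g \<in> M" using const.prems(2) by (simp add: I_def)
    then show ?case using const \<open>x \<in> carrier R\<close> by (simp add: P.m_ac)
  next
    case (step a p)
    let ?p = "poly_C R a \<oplus>\<^bsub>UP R\<^esub> poly_X R \<otimes>\<^bsub>UP R\<^esub> p"
    have pcl: "p i \<in> carrier R" for i using step.hyps by (simp add: UP_carrier_iff)
    have "?p 0 = a" "\<And>i. ?p (Suc i) = p i"
      using step.hyps pcl by (simp_all add: UP_add_apply poly_C_apply poly_X_mult_apply)
    with step.prems(1)[of 0] step.prems(1)[of "Suc i" for i]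
    have a: "a \<otimes> x \<in> I" and p: "\<And>i. p i \<otimes> x \<in> I" by auto
    have "poly_C R x \<otimes>\<^bsub>UP R\<^esub> (?p \<otimes>\<^bsub>UP R\<^esub> g) = poly_C R (a \<otimes> x) \<otimes>\<^bsub>UP R\<^esub> g
        \<oplus>\<^bsub>UP R\<^esub> poly_C R x \<otimes>\<^bsub>UP R\<^esub> (p \<otimes>\<^bsub>UP R\<^esub> (poly_X R \<otimes>\<^bsub>UP R\<^esub> g))"
      using step.hyps step.prems(2) \<open>x \<in> carrier R\<close>
      by (simp add: P.l_distr P.r_distr P.m_ac)
    also have "\<dots> \<in> M"
      using a step.prems(2) by (intro M_add step.IH[OF p]) (auto simp: I_def)
    finally show ?case .
  qed
  let ?f1 = "\<lambda>n. f (Suc n)" and ?f2 = "\<lambda>n. f (Suc (Suc n))"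
  have f1: "?f1 \<in> carrier (UP R)" by (rule poly_decompose(1)[OF f])
  have f2: "?f2 \<in> carrier (UP R)" using poly_decompose(1)[OF f1] .
  have f_eq: "f = poly_C R (f 0) \<oplus>\<^bsub>UP R\<^esub> poly_X R \<otimes>\<^bsub>UP R\<^esub>
      (poly_C R (f 1) \<oplus>\<^bsub>UP R\<^esub> poly_X R \<otimes>\<^bsub>UP R\<^esub> ?f2)"
    using poly_decompose(2)[OF f] poly_decompose(2)[OF f1] by simp
  from unit obtain u where u: "u \<in> carrier R" "u \<otimes> f 1 = \<one>" by (auto simp: Units_def)
  have absorb: "x \<in> I" if x: "x \<in> carrier R" and fx: "\<And>i. i \<ge> 2 \<Longrightarrow> f i \<otimes> x \<in> I" for x
  proof -
    have "poly_C R x \<otimes>\<^bsub>UP R\<^esub> g \<in> M" if "g \<in> carrier (UP R)" for g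
      using that
    proof (induction rule: poly_induct)
      case (const a)
      then have "poly_C R (x \<otimes> a) \<in> M" using x by (intro M_const) simp
      then show ?case using const x by simp
    next
      case (step a g)
      let ?U = "UP R" and ?x = "poly_C R x" and ?u = "poly_C R u" and ?f0 = "poly_C R (f 0)"
      have ufU: "?u \<otimes>\<^bsub>?U\<^esub> poly_C R (f 1) = \<one>\<^bsub>?U\<^esub>"
        using C.hom_mult[OF u(1) f_cl[of 1]] u(2) by simp
      have "?x \<otimes>\<^bsub>?U\<^esub> (poly_X R \<otimes>\<^bsub>?U\<^esub> g) = ?u \<otimes>\<^bsub>?U\<^esub> (f \<otimes>\<^bsub>?U\<^esub> (?x \<otimes>\<^bsub>?U\<^esub> g))
        \<oplus>\<^bsub>?U\<^esub> ((\<ominus>\<^bsub>?U\<^esub> (?u \<otimes>\<^bsub>?U\<^esub> ?f0)) \<otimes>\<^bsub>?U\<^esub> (?x \<otimes>\<^bsub>?U\<^esub> g)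
        \<oplus>\<^bsub>?U\<^esub> (\<ominus>\<^bsub>?U\<^esub> ?u) \<otimes>\<^bsub>?U\<^esub> (?x \<otimes>\<^bsub>?U\<^esub> (?f2 \<otimes>\<^bsub>?U\<^esub> (poly_X R \<otimes>\<^bsub>?U\<^esub> (poly_X R \<otimes>\<^bsub>?U\<^esub> g)))))"
        using f_cl u(1) x step.hyps f2
        by (subst f_eq) (intro P.horner_solve ufU poly_C_closed poly_X_closed)
      also have "\<dots> = ?u \<otimes>\<^bsub>?U\<^esub> (f \<otimes>\<^bsub>?U\<^esub> (?x \<otimes>\<^bsub>?U\<^esub> g))
        \<oplus>\<^bsub>?U\<^esub> (poly_C R (\<ominus> (u \<otimes> f 0)) \<otimes>\<^bsub>?U\<^esub> (?x \<otimes>\<^bsub>?U\<^esub> g)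
        \<oplus>\<^bsub>?U\<^esub> poly_C R (\<ominus> u) \<otimes>\<^bsub>?U\<^esub> (?x \<otimes>\<^bsub>?U\<^esub> (?f2 \<otimes>\<^bsub>?U\<^esub> (poly_X R \<otimes>\<^bsub>?U\<^esub> (poly_X R \<otimes>\<^bsub>?U\<^esub> g)))))"
        using u(1) f_cl[of 0] by simp
      also have "\<dots> \<in> M"
      proof (intro M_add)
        show "?u \<otimes>\<^bsub>?U\<^esub> (f \<otimes>\<^bsub>?U\<^esub> (?x \<otimes>\<^bsub>?U\<^esub> g)) \<in> M"
          by (rule M_smult[OF u(1) M_f]) (use x step.hyps in simp)
        show "poly_C R (\<ominus> (u \<otimes> f 0)) \<otimes>\<^bsub>?U\<^esub> (?x \<otimes>\<^bsub>?U\<^esub> g) \<in> M"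
          by (rule M_smult[OF _ step.IH]) (use u(1) f_cl in simp)
        have "?x \<otimes>\<^bsub>?U\<^esub> (?f2 \<otimes>\<^bsub>?U\<^esub> (poly_X R \<otimes>\<^bsub>?U\<^esub> (poly_X R \<otimes>\<^bsub>?U\<^esub> g))) \<in> M"
          by (rule poly_absorb[OF x f2 fx]) (use step.hyps in auto)
        then show "poly_C R (\<ominus> u) \<otimes>\<^bsub>?U\<^esub> (?x \<otimes>\<^bsub>?U\<^esub>
            (?f2 \<otimes>\<^bsub>?U\<^esub> (poly_X R \<otimes>\<^bsub>?U\<^esub> (poly_X R \<otimes>\<^bsub>?U\<^esub> g)))) \<in> M"
          by (rule M_smult[rotated]) (use u(1) in simp)
      qed
      finally have "?x \<otimes>\<^bsub>?U\<^esub> (poly_X R \<otimes>\<^bsub>?U\<^esub> g) \<in> M" .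
      then have "poly_C R (x \<otimes> a) \<oplus>\<^bsub>?U\<^esub> ?x \<otimes>\<^bsub>?U\<^esub> (poly_X R \<otimes>\<^bsub>?U\<^esub> g) \<in> M"
        using x step.hyps by (intro M_add M_const) auto
      then show ?case using x step.hyps by (simp add: P.r_distr)
    qed
    with x show ?thesis by (simp add: I_def)
  qed
  from f obtain N where N: "\<And>n. n > N \<Longrightarrow> f n = \<zero>" by (auto simp: UP_carrier_iff)
  have "\<one> \<in> I"
  proof (rule absorb_nilpotent_family[of "{2..N}" f])
    fix x assume x: "x \<in> carrier R" "\<And>i. i \<in> {2..N} \<Longrightarrow> f i \<otimes> x \<in> I"
    have "f i \<otimes> x \<in> I" if "i \<ge> 2" for i
      using that x N[of i] zero_I by (cases "i \<le> N") auto
    with x(1) show "x \<in> I" by (rule absorb)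
  qed (use f_cl nil zero_I I_mult in auto)
  then have "poly_C R \<one> \<otimes>\<^bsub>UP R\<^esub> poly_X R \<in> M" by (simp add: I_def)
  then have "poly_X R \<in> M" by simp
  then show ?thesis by (auto simp: M_def)
qed

text \<open>
  The preceding lemma gives \<open>X - c = f q\<close>, and evaluation at \<open>c\<close> gives \<open>f(c) q(c) = 0\<close>. It
  remains to see that \<open>q(c)\<close> is a unit. Modulo a prime ideal \<open>P\<close> both \<open>f\<close> and \<open>X - c\<close> have
  degree one, so \<open>q\<close> is a nonzero constant; if \<open>q(c)\<close> were in \<open>P\<close>, then \<open>X - c\<close> would
  divide \<open>q\<close> modulo \<open>P\<close>, which is impossible by degrees.
\<close>

lemma (in cring) root_if_linear_modulo_primes:
  assumes f: "f \<in> carrier (UP R)"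
    and lin: "\<And>P. primeideal P R \<Longrightarrow> f 1 \<notin> P"
      "\<And>P i. \<lbrakk>primeideal P R; i \<ge> 2\<rbrakk> \<Longrightarrow> f i \<in> P"
  obtains c q q' where "c \<in> carrier R" "q \<in> carrier (UP R)" "q' \<in> carrier (UP R)"
    "poly_X R \<ominus>\<^bsub>UP R\<^esub> poly_C R c = f \<otimes>\<^bsub>UP R\<^esub> q"
    "f = (poly_X R \<ominus>\<^bsub>UP R\<^esub> poly_C R c) \<otimes>\<^bsub>UP R\<^esub> q'"
proof -
  interpret P: cring "UP R" by (rule UP_is_cring)
  have f_cl: "f i \<in> carrier R" for i using f by (simp add: UP_carrier_iff)
  have "f 1 \<in> Units R" by (rule unit_if_in_no_prime[OF f_cl lin(1)])
  moreover have "\<exists>n::nat. f i [^] n = \<zero>" if "i \<ge> 2" for i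
    by (rule nilpotent_if_in_all_primes[OF f_cl lin(2)[OF _ that]])
  ultimately obtain c q where c: "c \<in> carrier R" and q: "q \<in> carrier (UP R)"
    and X: "poly_X R = poly_C R c \<oplus>\<^bsub>UP R\<^esub> f \<otimes>\<^bsub>UP R\<^esub> q"
    using variable_congruent_to_constant[OF f] by blast
  have Xc: "poly_X R \<ominus>\<^bsub>UP R\<^esub> poly_C R c = f \<otimes>\<^bsub>UP R\<^esub> q"
    unfolding X by (rule P.add_minus_cancel[symmetric]) (use c f q in auto)
  obtain e where e: "e \<in> ring_hom (UP R) R" "\<And>a. a \<in> carrier R \<Longrightarrow> e (poly_C R a) = a" "e (poly_X R) = c"
    using evaluation_hom[OF c] by blast
  interpret e: ring_hom_cring "UP R" R e by (rule ring_hom_cringI[OF UP_is_cring is_cring e(1)])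
  obtain q2 where q2: "q2 \<in> carrier (UP R)"
    "q = (poly_X R \<ominus>\<^bsub>UP R\<^esub> poly_C R c) \<otimes>\<^bsub>UP R\<^esub> q2 \<oplus>\<^bsub>UP R\<^esub> poly_C R (e q)"
    using factor_theorem[OF c e q] by blast
  have "e q \<notin> P" if P: "primeideal P R" for P
  proof
    assume eqP: "e q \<in> P"
    interpret I: primeideal P R by (rule P)
    let ?D = "R Quot P" and ?h = "\<lambda>x. P +> x"
    interpret D: "domain" ?D by (rule I.quotient_is_domain)
    interpret PD: "domain" "UP ?D" by (rule D.UP_is_domain)
    have h: "?h \<in> ring_hom R ?D" by (rule I.rcos_ring_hom)
    let ?H = "\<lambda>p n. ?h (p n)"
    interpret H: ring_hom_cring "UP R" "UP ?D" ?H
      by (rule ring_hom_cringI[OF UP_is_cring PD.is_cring UP_hom_map[OF D.is_cring h]])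
    have h0: "?h \<zero> = \<zero>\<^bsub>?D\<^esub>" by (rule ring_hom_zero[OF h local.ring_axioms D.ring_axioms])
    have HX: "?H (poly_X R) = poly_X ?D"
      using ring_hom_one[OF h] h0 by (simp add: fun_eq_iff poly_X_apply D.poly_X_apply)
    have hc: "?h a \<in> carrier ?D" if "a \<in> carrier R" for a by (rule ring_hom_closed[OF h that])
    have HC: "?H (poly_C R a) = poly_C ?D (?h a)" if "a \<in> carrier R" for a
      using h0 hc[OF that] by (simp add: fun_eq_iff poly_C_apply[OF that] D.poly_C_apply)
    let ?Y = "poly_X ?D \<ominus>\<^bsub>UP ?D\<^esub> poly_C ?D (?h c)"
    have Y: "?Y \<in> carrier (UP ?D)" using hc[OF c] by (simp add: D.poly_X_closed D.poly_C_closed)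
    have dY: "deg ?D ?Y = 1" by (rule D.deg_poly_X_minus_C[OF hc[OF c]])
    have HXc: "?H (poly_X R \<ominus>\<^bsub>UP R\<^esub> poly_C R c) = ?Y"
      using H.hom_add[of "poly_X R" "\<ominus>\<^bsub>UP R\<^esub> poly_C R c"] H.hom_a_inv[of "poly_C R c"] c HX HC[OF c]
      by (simp add: P.minus_eq PD.minus_eq)
    have cl: "?H f \<in> carrier (UP ?D)" "?H q \<in> carrier (UP ?D)" "?H q2 \<in> carrier (UP ?D)"
      using H.hom_closed[OF f] H.hom_closed[OF q] H.hom_closed[OF q2(1)] by auto
    have Yfq: "?Y = ?H f \<otimes>\<^bsub>UP ?D\<^esub> ?H q"
      unfolding HXc[symmetric] Xc by (rule H.hom_mult[OF f q])
    have d0: "deg ?D \<zero>\<^bsub>UP ?D\<^esub> = 0"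
      by (rule UP_ring.deg_zero) (simp add: UP_ring_def D.ring_axioms)
    have Ynz: "?Y \<noteq> \<zero>\<^bsub>UP ?D\<^esub>" using dY d0 by auto
    have "deg ?D (?H f) = 1"
      using D.deg_eq_1_iff[OF cl(1)] lin[OF P] I.coset_eq_zero_iff f_cl by auto
    moreover have nz: "?H f \<noteq> \<zero>\<^bsub>UP ?D\<^esub>" "?H q \<noteq> \<zero>\<^bsub>UP ?D\<^esub>"
      using Yfq Ynz cl by auto
    ultimately have dq: "deg ?D (?H q) = 0"
      using D.deg_UP_mult[OF cl(1,2) nz] Yfq dY by simp
    have eqR: "e q \<in> carrier R" by (rule e.hom_closed[OF q])
    have "poly_C ?D (?h (e q)) = \<zero>\<^bsub>UP ?D\<^esub>"
      using eqP I.coset_eq_zero_iff[OF eqR] hc[OF eqR]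
      by (simp add: fun_eq_iff D.poly_C_apply D.UP_zero_apply)
    moreover have "?H q = ?Y \<otimes>\<^bsub>UP ?D\<^esub> ?H q2 \<oplus>\<^bsub>UP ?D\<^esub> poly_C ?D (?h (e q))"
    proof -
      have Xcl: "poly_X R \<ominus>\<^bsub>UP R\<^esub> poly_C R c \<in> carrier (UP R)" using c by simp
      have "?H q = ?H ((poly_X R \<ominus>\<^bsub>UP R\<^esub> poly_C R c) \<otimes>\<^bsub>UP R\<^esub> q2 \<oplus>\<^bsub>UP R\<^esub> poly_C R (e q))"
        using q2(2) by simp
      also have "\<dots> = ?H (poly_X R \<ominus>\<^bsub>UP R\<^esub> poly_C R c) \<otimes>\<^bsub>UP ?D\<^esub> ?H q2 \<oplus>\<^bsub>UP ?D\<^esub> ?H (poly_C R (e q))"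
        using H.hom_add[OF P.m_closed[OF Xcl q2(1)] poly_C_closed[OF eqR]] H.hom_mult[OF Xcl q2(1)]
        by simp
      finally show ?thesis unfolding HXc HC[OF eqR] .
    qed
    ultimately have Hq: "?H q = ?Y \<otimes>\<^bsub>UP ?D\<^esub> ?H q2" using Y cl by simp
    then have "?H q2 \<noteq> \<zero>\<^bsub>UP ?D\<^esub>" using nz(2) Y by auto
    then have "deg ?D (?H q) = 1 + deg ?D (?H q2)"
      using D.deg_UP_mult[OF Y cl(3) Ynz] Hq dY by simp
    with dq show False by simp
  qed
  then have unit: "e q \<in> Units R" by (intro unit_if_in_no_prime e.hom_closed[OF q])
  have "e f \<otimes> e q = e (poly_X R \<ominus>\<^bsub>UP R\<^esub> poly_C R c)" unfolding Xc using f q by simp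
  also have "\<dots> = \<zero>" using c e by (simp add: P.minus_eq r_neg)
  finally have "e f \<otimes> e q = \<zero>" .
  moreover obtain v where "v \<in> carrier R" "e q \<otimes> v = \<one>"
    using unit by (auto simp: Units_def)
  ultimately have "e f = \<zero>"
    using e.hom_closed[OF f] e.hom_closed[OF q] m_assoc[of "e f" "e q" v] by simp
  obtain q' where q': "q' \<in> carrier (UP R)"
    "f = (poly_X R \<ominus>\<^bsub>UP R\<^esub> poly_C R c) \<otimes>\<^bsub>UP R\<^esub> q' \<oplus>\<^bsub>UP R\<^esub> poly_C R (e f)"
    using factor_theorem[OF c e f] by blast
  have "poly_C R (e f) = \<zero>\<^bsub>UP R\<^esub>"
    unfolding \<open>e f = \<zero>\<close> by (simp add: fun_eq_iff poly_C_apply UP_zero_apply)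
  with q' c have "f = (poly_X R \<ominus>\<^bsub>UP R\<^esub> poly_C R c) \<otimes>\<^bsub>UP R\<^esub> q'" by simp
  with that c q q'(1) Xc show thesis by blast
qed

section \<open>The Poisson center\<close>

context poisson_algebra
begin

lemma pbracket_antisym:
  assumes a: "a \<in> carrier A" and b: "b \<in> carrier A"
  shows "\<lbrace>a, b\<rbrace>\<^bsub>A\<^esub> = \<ominus>\<^bsub>A\<^esub> \<lbrace>b, a\<rbrace>\<^bsub>A\<^esub>"
proof -
  have "\<lbrace>a \<oplus>\<^bsub>A\<^esub> b, a \<oplus>\<^bsub>A\<^esub> b\<rbrace>\<^bsub>A\<^esub> = \<zero>\<^bsub>A\<^esub>" using a b by (intro pbracket_self) simp
  then have "\<lbrace>a, b\<rbrace>\<^bsub>A\<^esub> \<oplus>\<^bsub>A\<^esub> \<lbrace>b, a\<rbrace>\<^bsub>A\<^esub> = \<zero>\<^bsub>A\<^esub>"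
    using a b by (simp add: pbracket_add_left pbracket_add_right pbracket_self[OF a] pbracket_self[OF b] M.a_comm)
  then show ?thesis using a b by (intro M.minus_equality[symmetric]) simp_all
qed

text \<open>
  The Leibniz rule is given for the right argument, so centrality is most easily used on that side.
\<close>

lemma center_iff: "z \<in> poisson_center A \<longleftrightarrow> z \<in> carrier A \<and> (\<forall>a \<in> carrier A. \<lbrace>a, z\<rbrace>\<^bsub>A\<^esub> = \<zero>\<^bsub>A\<^esub>)"
proof -
  have "\<lbrace>z, a\<rbrace>\<^bsub>A\<^esub> = \<zero>\<^bsub>A\<^esub> \<longleftrightarrow> \<lbrace>a, z\<rbrace>\<^bsub>A\<^esub> = \<zero>\<^bsub>A\<^esub>" if "z \<in> carrier A" "a \<in> carrier A" for a
    using pbracket_antisym[OF that] pbracket_antisym[OF that(2,1)] by auto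
  then show ?thesis by (auto simp: poisson_center_def)
qed

lemma center_subset: "poisson_center A \<subseteq> carrier A"
  by (auto simp: poisson_center_def)

lemma pbracket_center_mult_left:
  assumes c: "c \<in> poisson_center A" and a: "a \<in> carrier A" and b: "b \<in> carrier A"
  shows "\<lbrace>c \<otimes>\<^bsub>A\<^esub> a, b\<rbrace>\<^bsub>A\<^esub> = c \<otimes>\<^bsub>A\<^esub> \<lbrace>a, b\<rbrace>\<^bsub>A\<^esub>"
proof -
  have c': "c \<in> carrier A" "\<lbrace>b, c\<rbrace>\<^bsub>A\<^esub> = \<zero>\<^bsub>A\<^esub>" using c b by (simp_all add: center_iff)
  have "\<lbrace>c \<otimes>\<^bsub>A\<^esub> a, b\<rbrace>\<^bsub>A\<^esub> = \<ominus>\<^bsub>A\<^esub> \<lbrace>b, c \<otimes>\<^bsub>A\<^esub> a\<rbrace>\<^bsub>A\<^esub>"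
    using a b c' by (intro pbracket_antisym) simp_all
  also have "\<dots> = c \<otimes>\<^bsub>A\<^esub> (\<ominus>\<^bsub>A\<^esub> \<lbrace>b, a\<rbrace>\<^bsub>A\<^esub>)"
    using a b c' by (simp add: pbracket_leibniz r_minus)
  also have "\<dots> = c \<otimes>\<^bsub>A\<^esub> \<lbrace>a, b\<rbrace>\<^bsub>A\<^esub>"
    using pbracket_antisym[OF a b] by simp
  finally show ?thesis .
qed

lemma pbracket_center_mult_right:
  assumes c: "c \<in> poisson_center A" and a: "a \<in> carrier A" and b: "b \<in> carrier A"
  shows "\<lbrace>a, c \<otimes>\<^bsub>A\<^esub> b\<rbrace>\<^bsub>A\<^esub> = c \<otimes>\<^bsub>A\<^esub> \<lbrace>a, b\<rbrace>\<^bsub>A\<^esub>"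
  using assms by (simp add: center_iff pbracket_leibniz)

lemma center_subcring: "subcring (poisson_center A) A"
proof (rule subcringI')
  show "subring (poisson_center A) A"
  proof (rule subringI)
    show "poisson_center A \<subseteq> carrier A" by (rule center_subset)
    show "\<one>\<^bsub>A\<^esub> \<in> poisson_center A" by (simp add: poisson_center_def pbracket_one_left)
    fix z w assume z: "z \<in> poisson_center A"
    show "\<ominus>\<^bsub>A\<^esub> z \<in> poisson_center A"
    proof -
      have "\<lbrace>\<ominus>\<^bsub>A\<^esub> z, a\<rbrace>\<^bsub>A\<^esub> = \<zero>\<^bsub>A\<^esub>" if a: "a \<in> carrier A" for a
        using pbracket_add_left[of z "\<ominus>\<^bsub>A\<^esub> z" a] z a
        by (simp add: poisson_center_def M.r_neg pbracket_zero_left)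
      then show ?thesis using z by (simp add: poisson_center_def)
    qed
    assume w: "w \<in> poisson_center A"
    show "z \<oplus>\<^bsub>A\<^esub> w \<in> poisson_center A" "z \<otimes>\<^bsub>A\<^esub> w \<in> poisson_center A"
      using z w pbracket_center_mult_left[OF z] by (auto simp: poisson_center_def pbracket_add_left)
  qed
qed

lemma center_cring: "cring (A\<lparr>carrier := poisson_center A\<rparr>)"
  using subcring_iff[OF center_subset] center_subcring by simp

section \<open>Polynomials over a Poisson algebra\<close>

lemma poly_bracket_apply:
  "\<lbrace>p, q\<rbrace>\<^bsub>poisson_poly A\<^esub> n = (\<Oplus>\<^bsub>A\<^esub>i \<in> {..n}. \<lbrace>p i, q (n - i)\<rbrace>\<^bsub>A\<^esub>)"
  by (simp add: poisson_poly_def)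

lemma poly_bracket_closed:
  assumes p: "p \<in> carrier (UP A)" and q: "q \<in> carrier (UP A)"
  shows "\<lbrace>p, q\<rbrace>\<^bsub>poisson_poly A\<^esub> \<in> carrier (UP A)"
proof -
  from p q obtain N M where N: "\<And>n. n > N \<Longrightarrow> p n = \<zero>\<^bsub>A\<^esub>" and M: "\<And>n. n > M \<Longrightarrow> q n = \<zero>\<^bsub>A\<^esub>"
    by (auto simp: UP_carrier_iff)
  have cl: "p n \<in> carrier A" "q n \<in> carrier A" for n using p q by (auto simp: UP_carrier_iff)
  have "\<lbrace>p, q\<rbrace>\<^bsub>poisson_poly A\<^esub> n = \<zero>\<^bsub>A\<^esub>" if n: "n > N + M" for n
  proof -
    have "\<lbrace>p i, q (n - i)\<rbrace>\<^bsub>A\<^esub> = \<zero>\<^bsub>A\<^esub>" for i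
      using n N[of i] M[of "n - i"] cl
      by (cases "i > N") (auto simp: pbracket_zero_left pbracket_zero_right)
    then show ?thesis by (simp add: poly_bracket_apply)
  qed
  with cl show ?thesis
    by (auto simp: UP_carrier_iff poly_bracket_apply intro!: M.finsum_closed exI[of _ "N + M"])
qed

lemma poly_bracket_C_C:
  "\<lbrakk>a \<in> carrier A; b \<in> carrier A\<rbrakk>
    \<Longrightarrow> \<lbrace>poly_C A a, poly_C A b\<rbrace>\<^bsub>poisson_poly A\<^esub> = poly_C A \<lbrace>a, b\<rbrace>\<^bsub>A\<^esub>"
  using pbracket_monom[of a b 0 0] by (simp add: poly_C_def)

text \<open>
  Bracketing with constants reads off the brackets of the coefficients; this is why
  the coefficients of a central polynomial are central.
\<close>

lemma poly_bracket_C_right: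
  assumes p: "p \<in> carrier (UP A)" and a: "a \<in> carrier A"
  shows "\<lbrace>p, poly_C A a\<rbrace>\<^bsub>poisson_poly A\<^esub> n = \<lbrace>p n, a\<rbrace>\<^bsub>A\<^esub>"
proof -
  have cl: "p n \<in> carrier A" for n using p by (simp add: UP_carrier_iff)
  have "\<lbrace>p, poly_C A a\<rbrace>\<^bsub>poisson_poly A\<^esub> n = (\<Oplus>\<^bsub>A\<^esub>i \<in> {..n}. if n = i then \<lbrace>p i, a\<rbrace>\<^bsub>A\<^esub> else \<zero>\<^bsub>A\<^esub>)"
    unfolding poly_bracket_apply
    using cl a by (intro M.finsum_cong') (auto simp: poly_C_apply pbracket_zero_right)
  also have "\<dots> = \<lbrace>p n, a\<rbrace>\<^bsub>A\<^esub>"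
    using cl a by (intro M.finsum_singleton) auto
  finally show ?thesis .
qed

lemma center_poly:
  "poisson_center (poisson_poly A) = carrier (UP (A\<lparr>carrier := poisson_center A\<rparr>))"
proof (intro subset_antisym subsetI)
  fix z assume "z \<in> poisson_center (poisson_poly A)"
  then have z: "z \<in> carrier (UP A)"
    and br: "\<And>q. q \<in> carrier (UP A) \<Longrightarrow> \<lbrace>z, q\<rbrace>\<^bsub>poisson_poly A\<^esub> = \<zero>\<^bsub>UP A\<^esub>"
    by (auto simp: poisson_center_def poisson_poly_def)
  have "z n \<in> poisson_center A" for n
    unfolding poisson_center_def
    using z br[OF poly_C_closed] poly_bracket_C_right[OF z]
    by (auto simp: UP_carrier_iff) (metis UP_zero_apply)
  with z show "z \<in> carrier (UP (A\<lparr>carrier := poisson_center A\<rparr>))" by (simp add: UP_carrier_iff)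
next
  fix z assume "z \<in> carrier (UP (A\<lparr>carrier := poisson_center A\<rparr>))"
  then have z: "z \<in> carrier (UP A)" and c: "\<And>n. z n \<in> poisson_center A"
    using center_subset by (auto simp: UP_carrier_iff)
  have "\<lbrace>z, q\<rbrace>\<^bsub>poisson_poly A\<^esub> = \<zero>\<^bsub>UP A\<^esub>" if q: "q \<in> carrier (UP A)" for q
  proof
    fix n
    have "\<lbrace>z i, q (n - i)\<rbrace>\<^bsub>A\<^esub> = \<zero>\<^bsub>A\<^esub>" for i
      using c[of i] q by (simp add: poisson_center_def UP_carrier_iff)
    then show "\<lbrace>z, q\<rbrace>\<^bsub>poisson_poly A\<^esub> n = \<zero>\<^bsub>UP A\<^esub> n"
      by (simp add: poly_bracket_apply UP_zero_apply)
  qed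
  with z show "z \<in> poisson_center (poisson_poly A)"
    by (simp add: poisson_center_def poisson_poly_def)
qed

lemma poly_bracket_add_left:
  assumes "p \<in> carrier (UP A)" "p' \<in> carrier (UP A)" "q \<in> carrier (UP A)"
  shows "\<lbrace>p \<oplus>\<^bsub>UP A\<^esub> p', q\<rbrace>\<^bsub>poisson_poly A\<^esub>
    = \<lbrace>p, q\<rbrace>\<^bsub>poisson_poly A\<^esub> \<oplus>\<^bsub>UP A\<^esub> \<lbrace>p', q\<rbrace>\<^bsub>poisson_poly A\<^esub>"
proof
  fix n
  have cl: "p n \<in> carrier A" "p' n \<in> carrier A" "q n \<in> carrier A" for n
    using assms by (auto simp: UP_carrier_iff)
  have "\<lbrace>p \<oplus>\<^bsub>UP A\<^esub> p', q\<rbrace>\<^bsub>poisson_poly A\<^esub> n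
      = (\<Oplus>\<^bsub>A\<^esub>i \<in> {..n}. \<lbrace>p i, q (n - i)\<rbrace>\<^bsub>A\<^esub> \<oplus>\<^bsub>A\<^esub> \<lbrace>p' i, q (n - i)\<rbrace>\<^bsub>A\<^esub>)"
    unfolding poly_bracket_apply using assms cl
    by (intro M.finsum_cong') (auto simp: UP_add_apply pbracket_add_left)
  also have "\<dots> = \<lbrace>p, q\<rbrace>\<^bsub>poisson_poly A\<^esub> n \<oplus>\<^bsub>A\<^esub> \<lbrace>p', q\<rbrace>\<^bsub>poisson_poly A\<^esub> n"
    unfolding poly_bracket_apply using cl by (intro M.finsum_addf) auto
  also have "\<dots> = (\<lbrace>p, q\<rbrace>\<^bsub>poisson_poly A\<^esub> \<oplus>\<^bsub>UP A\<^esub> \<lbrace>p', q\<rbrace>\<^bsub>poisson_poly A\<^esub>) n"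
    using UP_add_apply[OF poly_bracket_closed[OF assms(1,3)] poly_bracket_closed[OF assms(2,3)]]
    by simp
  finally show "\<lbrace>p \<oplus>\<^bsub>UP A\<^esub> p', q\<rbrace>\<^bsub>poisson_poly A\<^esub> n
    = (\<lbrace>p, q\<rbrace>\<^bsub>poisson_poly A\<^esub> \<oplus>\<^bsub>UP A\<^esub> \<lbrace>p', q\<rbrace>\<^bsub>poisson_poly A\<^esub>) n" .
qed

lemma poly_bracket_add_right:
  assumes "p \<in> carrier (UP A)" "q \<in> carrier (UP A)" "q' \<in> carrier (UP A)"
  shows "\<lbrace>p, q \<oplus>\<^bsub>UP A\<^esub> q'\<rbrace>\<^bsub>poisson_poly A\<^esub>
    = \<lbrace>p, q\<rbrace>\<^bsub>poisson_poly A\<^esub> \<oplus>\<^bsub>UP A\<^esub> \<lbrace>p, q'\<rbrace>\<^bsub>poisson_poly A\<^esub>"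
proof
  fix n
  have cl: "p n \<in> carrier A" "q n \<in> carrier A" "q' n \<in> carrier A" for n
    using assms by (auto simp: UP_carrier_iff)
  have "\<lbrace>p, q \<oplus>\<^bsub>UP A\<^esub> q'\<rbrace>\<^bsub>poisson_poly A\<^esub> n
      = (\<Oplus>\<^bsub>A\<^esub>i \<in> {..n}. \<lbrace>p i, q (n - i)\<rbrace>\<^bsub>A\<^esub> \<oplus>\<^bsub>A\<^esub> \<lbrace>p i, q' (n - i)\<rbrace>\<^bsub>A\<^esub>)"
    unfolding poly_bracket_apply using assms cl
    by (intro M.finsum_cong') (auto simp: UP_add_apply pbracket_add_right)
  also have "\<dots> = \<lbrace>p, q\<rbrace>\<^bsub>poisson_poly A\<^esub> n \<oplus>\<^bsub>A\<^esub> \<lbrace>p, q'\<rbrace>\<^bsub>poisson_poly A\<^esub> n"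
    unfolding poly_bracket_apply using cl by (intro M.finsum_addf) auto
  also have "\<dots> = (\<lbrace>p, q\<rbrace>\<^bsub>poisson_poly A\<^esub> \<oplus>\<^bsub>UP A\<^esub> \<lbrace>p, q'\<rbrace>\<^bsub>poisson_poly A\<^esub>) n"
    using UP_add_apply[OF poly_bracket_closed[OF assms(1,2)] poly_bracket_closed[OF assms(1,3)]]
    by simp
  finally show "\<lbrace>p, q \<oplus>\<^bsub>UP A\<^esub> q'\<rbrace>\<^bsub>poisson_poly A\<^esub> n
    = (\<lbrace>p, q\<rbrace>\<^bsub>poisson_poly A\<^esub> \<oplus>\<^bsub>UP A\<^esub> \<lbrace>p, q'\<rbrace>\<^bsub>poisson_poly A\<^esub>) n" .
qed

lemma poly_bracket_X_left:
  assumes p: "p \<in> carrier (UP A)" and q: "q \<in> carrier (UP A)"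
  shows "\<lbrace>poly_X A \<otimes>\<^bsub>UP A\<^esub> p, q\<rbrace>\<^bsub>poisson_poly A\<^esub> = poly_X A \<otimes>\<^bsub>UP A\<^esub> \<lbrace>p, q\<rbrace>\<^bsub>poisson_poly A\<^esub>"
proof
  fix n
  have cl: "p n \<in> carrier A" "q n \<in> carrier A" for n
    using assms by (auto simp: UP_carrier_iff)
  show "\<lbrace>poly_X A \<otimes>\<^bsub>UP A\<^esub> p, q\<rbrace>\<^bsub>poisson_poly A\<^esub> n = (poly_X A \<otimes>\<^bsub>UP A\<^esub> \<lbrace>p, q\<rbrace>\<^bsub>poisson_poly A\<^esub>) n"
  proof (cases n)
    case 0
    then show ?thesis using cl
      by (simp add: poly_X_mult_apply[OF p] poly_X_mult_apply[OF poly_bracket_closed[OF p q]]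
          poly_bracket_apply pbracket_zero_left)
  next
    case (Suc m)
    have "\<lbrace>poly_X A \<otimes>\<^bsub>UP A\<^esub> p, q\<rbrace>\<^bsub>poisson_poly A\<^esub> n
        = (\<Oplus>\<^bsub>A\<^esub>i \<in> {..m}. \<lbrace>p i, q (m - i)\<rbrace>\<^bsub>A\<^esub>) \<oplus>\<^bsub>A\<^esub> \<lbrace>\<zero>\<^bsub>A\<^esub>, q n\<rbrace>\<^bsub>A\<^esub>"
      unfolding poly_bracket_apply Suc using cl
      by (subst M.finsum_Suc2) (auto simp: poly_X_mult_apply[OF p] split: nat.split)
    also have "\<dots> = (poly_X A \<otimes>\<^bsub>UP A\<^esub> \<lbrace>p, q\<rbrace>\<^bsub>poisson_poly A\<^esub>) n"
      using Suc cl
      by (simp add: poly_X_mult_apply[OF poly_bracket_closed[OF p q]] poly_bracket_apply pbracket_zero_left)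
    finally show ?thesis .
  qed
qed

lemma poly_bracket_X_right:
  assumes p: "p \<in> carrier (UP A)" and q: "q \<in> carrier (UP A)"
  shows "\<lbrace>p, poly_X A \<otimes>\<^bsub>UP A\<^esub> q\<rbrace>\<^bsub>poisson_poly A\<^esub> = poly_X A \<otimes>\<^bsub>UP A\<^esub> \<lbrace>p, q\<rbrace>\<^bsub>poisson_poly A\<^esub>"
proof
  fix n
  have cl: "p n \<in> carrier A" "q n \<in> carrier A" for n
    using assms by (auto simp: UP_carrier_iff)
  show "\<lbrace>p, poly_X A \<otimes>\<^bsub>UP A\<^esub> q\<rbrace>\<^bsub>poisson_poly A\<^esub> n = (poly_X A \<otimes>\<^bsub>UP A\<^esub> \<lbrace>p, q\<rbrace>\<^bsub>poisson_poly A\<^esub>) n"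
  proof (cases n)
    case 0
    then show ?thesis using cl
      by (simp add: poly_X_mult_apply[OF q] poly_X_mult_apply[OF poly_bracket_closed[OF p q]]
          poly_bracket_apply pbracket_zero_right)
  next
    case (Suc m)
    have "\<lbrace>p, poly_X A \<otimes>\<^bsub>UP A\<^esub> q\<rbrace>\<^bsub>poisson_poly A\<^esub> n
        = \<lbrace>p n, \<zero>\<^bsub>A\<^esub>\<rbrace>\<^bsub>A\<^esub> \<oplus>\<^bsub>A\<^esub> (\<Oplus>\<^bsub>A\<^esub>i \<in> {..m}. \<lbrace>p i, (poly_X A \<otimes>\<^bsub>UP A\<^esub> q) (Suc m - i)\<rbrace>\<^bsub>A\<^esub>)"
      unfolding poly_bracket_apply Suc using cl
      by (subst M.finsum_Suc) (auto simp: poly_X_mult_apply[OF q] split: nat.split)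
    also have "(\<Oplus>\<^bsub>A\<^esub>i \<in> {..m}. \<lbrace>p i, (poly_X A \<otimes>\<^bsub>UP A\<^esub> q) (Suc m - i)\<rbrace>\<^bsub>A\<^esub>)
        = (\<Oplus>\<^bsub>A\<^esub>i \<in> {..m}. \<lbrace>p i, q (m - i)\<rbrace>\<^bsub>A\<^esub>)"
      using cl by (intro M.finsum_cong') (auto simp: poly_X_mult_apply[OF q] Suc_diff_le)
    also have "\<lbrace>p n, \<zero>\<^bsub>A\<^esub>\<rbrace>\<^bsub>A\<^esub> \<oplus>\<^bsub>A\<^esub> \<dots> = (poly_X A \<otimes>\<^bsub>UP A\<^esub> \<lbrace>p, q\<rbrace>\<^bsub>poisson_poly A\<^esub>) n"
      using Suc cl
      by (simp add: poly_X_mult_apply[OF poly_bracket_closed[OF p q]] poly_bracket_apply pbracket_zero_right)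
    finally show ?thesis .
  qed
qed

text \<open>
  Both sides are additive in \<open>p\<close> and \<open>q\<close>; multiplying either argument by \<open>X\<close> multiplies the left
  side by \<open>c\<close>, and the right side as well because \<open>c\<close> is central. So it suffices
  to compare the two sides on constants.
\<close>

lemma evaluation_preserves_bracket:
  assumes c: "c \<in> poisson_center A" and e: "e \<in> ring_hom (UP A) A"
    and eC: "\<And>a. a \<in> carrier A \<Longrightarrow> e (poly_C A a) = a" and eX: "e (poly_X A) = c"
    and p: "p \<in> carrier (UP A)" and q: "q \<in> carrier (UP A)"
  shows "e \<lbrace>p, q\<rbrace>\<^bsub>poisson_poly A\<^esub> = \<lbrace>e p, e q\<rbrace>\<^bsub>A\<^esub>"
proof -
  interpret UA: cring "UP A" by (rule UP_is_cring)
  interpret e: ring_hom_cring "UP A" A e by (rule ring_hom_cringI[OF UP_is_cring is_cring e])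
  have c': "c \<in> carrier A" using c center_subset by blast
  note cl = poly_C_closed poly_X_closed poly_bracket_closed
  have right: "e \<lbrace>poly_C A a, q\<rbrace>\<^bsub>poisson_poly A\<^esub> = \<lbrace>a, e q\<rbrace>\<^bsub>A\<^esub>" if a: "a \<in> carrier A" for a
    using q
  proof (induction rule: poly_induct)
    case (const b)
    with a show ?case by (simp add: poly_bracket_C_C eC)
  next
    case (step b q)
    have "\<lbrace>poly_C A a, poly_C A b \<oplus>\<^bsub>UP A\<^esub> poly_X A \<otimes>\<^bsub>UP A\<^esub> q\<rbrace>\<^bsub>poisson_poly A\<^esub>
      = poly_C A \<lbrace>a, b\<rbrace>\<^bsub>A\<^esub> \<oplus>\<^bsub>UP A\<^esub> poly_X A \<otimes>\<^bsub>UP A\<^esub> \<lbrace>poly_C A a, q\<rbrace>\<^bsub>poisson_poly A\<^esub>"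
      using a step.hyps by (simp add: poly_bracket_add_right poly_bracket_C_C poly_bracket_X_right cl)
    with a step c' show ?case
      by (simp add: cl eC eX pbracket_add_right pbracket_center_mult_right[OF c])
  qed
  show ?thesis using p
  proof (induction rule: poly_induct)
    case (const a)
    then show ?case by (simp add: right eC)
  next
    case (step a p)
    have "\<lbrace>poly_C A a \<oplus>\<^bsub>UP A\<^esub> poly_X A \<otimes>\<^bsub>UP A\<^esub> p, q\<rbrace>\<^bsub>poisson_poly A\<^esub>
      = \<lbrace>poly_C A a, q\<rbrace>\<^bsub>poisson_poly A\<^esub> \<oplus>\<^bsub>UP A\<^esub> poly_X A \<otimes>\<^bsub>UP A\<^esub> \<lbrace>p, q\<rbrace>\<^bsub>poisson_poly A\<^esub>"
      using q step.hyps by (simp add: poly_bracket_add_left poly_bracket_X_left cl)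
    with q step c' show ?case
      by (simp add: cl eC eX right pbracket_add_left pbracket_center_mult_left[OF c])
  qed
qed

lemma poly_smult_eq_C_mult:
  assumes r: "r \<in> carrier K" and p: "p \<in> carrier (UP A)"
  shows "r \<odot>\<^bsub>poisson_poly A\<^esub> p = poly_C A (r \<odot>\<^bsub>A\<^esub> \<one>\<^bsub>A\<^esub>) \<otimes>\<^bsub>UP A\<^esub> p"
proof
  fix n
  have pn: "p n \<in> carrier A" using p by (simp add: UP_carrier_iff)
  have "(poly_C A (r \<odot>\<^bsub>A\<^esub> \<one>\<^bsub>A\<^esub>) \<otimes>\<^bsub>UP A\<^esub> p) n = (r \<odot>\<^bsub>A\<^esub> \<one>\<^bsub>A\<^esub>) \<otimes>\<^bsub>A\<^esub> p n"
    using r by (intro poly_C_mult_apply[OF _ p]) simp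
  also have "\<dots> = r \<odot>\<^bsub>A\<^esub> p n"
    using smult_assoc2[OF r one_closed pn] pn by simp
  finally show "(r \<odot>\<^bsub>poisson_poly A\<^esub> p) n = (poly_C A (r \<odot>\<^bsub>A\<^esub> \<one>\<^bsub>A\<^esub>) \<otimes>\<^bsub>UP A\<^esub> p) n"
    by (simp add: poisson_poly_def)
qed

lemma poly_C_smult:
  assumes r: "r \<in> carrier K" and a: "a \<in> carrier A"
  shows "poly_C A (r \<odot>\<^bsub>A\<^esub> a) = r \<odot>\<^bsub>poisson_poly A\<^esub> poly_C A a"
  using r a by (auto simp: fun_eq_iff poisson_poly_def poly_C_apply)

end

section \<open>Cancellation\<close>

lemma subcring_inclusion_poly_hom:
  assumes R: "cring R" and H: "subcring H R"
  shows "(\<lambda>p. p) \<in> ring_hom (UP (R\<lparr>carrier := H\<rparr>)) (UP R)"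
proof -
  have sub: "H \<subseteq> carrier R" using H by (rule subcringE(1))
  interpret R: cring R by (rule R)
  have H': "cring (R\<lparr>carrier := H\<rparr>)" using R.subcring_iff[OF sub] H by simp
  have "(\<lambda>x. x) \<in> ring_hom (R\<lparr>carrier := H\<rparr>) R"
    using sub by (auto simp: ring_hom_def)
  from cring.UP_hom_map[OF H' R this] show ?thesis by simp
qed

text \<open>
  Closure of the bracket is needed for one inclusion: from \<open>h {z, a} = 0\<close> one concludes \<open>{z, a} = 0\<close>
  by injectivity of \<open>h\<close> on the carrier.
\<close>

lemma poisson_iso_center:
  assumes h: "h \<in> poisson_iso K P Q"
    and P: "\<And>a b. \<lbrakk>a \<in> carrier P; b \<in> carrier P\<rbrakk> \<Longrightarrow> \<lbrace>a, b\<rbrace>\<^bsub>P\<^esub> \<in> carrier P"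
    and zero: "h \<zero>\<^bsub>P\<^esub> = \<zero>\<^bsub>Q\<^esub>" "\<zero>\<^bsub>P\<^esub> \<in> carrier P"
  shows "h ` poisson_center P = poisson_center Q"
proof -
  have inj: "inj_on h (carrier P)" and surj: "h ` carrier P = carrier Q"
    and br: "\<And>a b. \<lbrakk>a \<in> carrier P; b \<in> carrier P\<rbrakk> \<Longrightarrow> h \<lbrace>a, b\<rbrace>\<^bsub>P\<^esub> = \<lbrace>h a, h b\<rbrace>\<^bsub>Q\<^esub>"
    using h by (auto simp: poisson_iso_def ring_iso_def bij_betw_def)
  have "h z \<in> poisson_center Q \<longleftrightarrow> z \<in> poisson_center P" if z: "z \<in> carrier P" for z
  proof -
    have "h z \<in> poisson_center Q \<longleftrightarrow> (\<forall>a \<in> carrier P. \<lbrace>h z, h a\<rbrace>\<^bsub>Q\<^esub> = \<zero>\<^bsub>Q\<^esub>)"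
      using z unfolding poisson_center_def surj[symmetric] by simp
    also have "\<dots> \<longleftrightarrow> (\<forall>a \<in> carrier P. h \<lbrace>z, a\<rbrace>\<^bsub>P\<^esub> = h \<zero>\<^bsub>P\<^esub>)"
      using z br zero by simp
    also have "\<dots> \<longleftrightarrow> (\<forall>a \<in> carrier P. \<lbrace>z, a\<rbrace>\<^bsub>P\<^esub> = \<zero>\<^bsub>P\<^esub>)"
      using z P zero(2) inj_on_eq_iff[OF inj] by simp
    finally show ?thesis using z by (simp add: poisson_center_def)
  qed
  then have "h ` poisson_center P = h ` {z \<in> carrier P. h z \<in> poisson_center Q}"
    by (intro arg_cong[of _ _ "image h"]) (auto simp: poisson_center_def)
  also have "\<dots> = poisson_center Q"
    using surj by (auto simp: poisson_center_def image_iff)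
  finally show ?thesis .
qed

text \<open>
  With \<open>c\<close> as in \<open>root_if_linear_modulo_primes\<close>, let \<open>h(a)\<close> be the value of \<open>\<phi>(a)\<close> at \<open>c\<close>. If it
  vanishes, then \<open>s - c\<close>, hence \<open>f = \<phi>(t)\<close>, divides \<open>\<phi>(a)\<close>, so \<open>t\<close> divides \<open>a\<close> and \<open>a = 0\<close>.
  For \<open>b \<in> B\<close> write \<open>b = \<phi>(p)\<close> with \<open>p = p_0 + t p'\<close>; since \<open>f(c) = 0\<close>, evaluation at \<open>c\<close>
  turns this into \<open>b = h(p_0)\<close>.
\<close>

theorem poisson_cancellation:
  fixes A :: "('k, 'a) poisson" and B :: "('k, 'b) poisson"
  assumes A: "poisson_algebra K A" and B: "poisson_algebra K B"
    and pi: "strongly_pi_regular (A\<lparr>carrier := poisson_center A\<rparr>)"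
    and iso: "poisson_isomorphic K (poisson_poly A) (poisson_poly B)"
  shows "poisson_isomorphic K A B"
proof -
  interpret PA: poisson_algebra K A by (rule A)
  interpret PB: poisson_algebra K B by (rule B)
  have Ac: "cring A" and Bc: "cring B" by (rule PA.M_cring, rule PB.M_cring)
  let ?Z = "A\<lparr>carrier := poisson_center A\<rparr>" and ?W = "B\<lparr>carrier := poisson_center B\<rparr>"
  have Z: "cring ?Z" and W: "cring ?W" by (rule PA.center_cring, rule PB.center_cring)
  interpret UA: cring "UP A" by (rule cring.UP_is_cring[OF Ac])
  interpret UB: cring "UP B" by (rule cring.UP_is_cring[OF Bc])
  from iso obtain \<phi> where \<phi>: "\<phi> \<in> poisson_iso K (poisson_poly A) (poisson_poly B)"
    by (auto simp: poisson_isomorphic_def)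
  have hom: "\<phi> \<in> ring_hom (UP A) (UP B)" and bij: "bij_betw \<phi> (carrier (UP A)) (carrier (UP B))"
    using \<phi> by (auto simp: poisson_iso_def ring_iso_def ring_hom_def poisson_poly_def)
  have \<phi>_smult: "\<phi> (r \<odot>\<^bsub>poisson_poly A\<^esub> p) = r \<odot>\<^bsub>poisson_poly B\<^esub> \<phi> p"
    if "r \<in> carrier K" "p \<in> carrier (UP A)" for r p
    using \<phi> that by (auto simp: poisson_iso_def poisson_poly_def)
  have \<phi>_bracket: "\<phi> \<lbrace>p, q\<rbrace>\<^bsub>poisson_poly A\<^esub> = \<lbrace>\<phi> p, \<phi> q\<rbrace>\<^bsub>poisson_poly B\<^esub>"
    if "p \<in> carrier (UP A)" "q \<in> carrier (UP A)" for p q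
    using \<phi> that by (auto simp: poisson_iso_def poisson_poly_def)
  interpret \<phi>: ring_hom_cring "UP A" "UP B" \<phi>
    by (rule ring_hom_cringI[OF UA.is_cring UB.is_cring hom])
  have "\<phi> ` poisson_center (poisson_poly A) = poisson_center (poisson_poly B)"
  proof (rule poisson_iso_center[OF \<phi>])
    show "\<lbrace>p, q\<rbrace>\<^bsub>poisson_poly A\<^esub> \<in> carrier (poisson_poly A)"
      if "p \<in> carrier (poisson_poly A)" "q \<in> carrier (poisson_poly A)" for p q
      using PA.poly_bracket_closed[of p q] that by (simp add: poisson_poly_def)
  qed (use \<phi>.hom_zero in \<open>simp_all add: poisson_poly_def\<close>)
  then have img: "\<phi> ` carrier (UP ?Z) = carrier (UP ?W)"
    unfolding PA.center_poly PB.center_poly .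
  have iZ: "(\<lambda>p. p) \<in> ring_hom (UP ?Z) (UP A)"
    by (rule subcring_inclusion_poly_hom[OF Ac PA.center_subcring])
  have iW: "(\<lambda>p. p) \<in> ring_hom (UP ?W) (UP B)"
    by (rule subcring_inclusion_poly_hom[OF Bc PB.center_subcring])
  interpret iW: ring_hom_cring "UP ?W" "UP B" "\<lambda>p. p"
    by (rule ring_hom_cringI[OF cring.UP_is_cring[OF W] UB.is_cring iW])
  have \<phi>_center: "\<phi> \<in> ring_hom (UP ?Z) (UP ?W)"
  proof (rule ring_hom_memI)
    fix p q assume p: "p \<in> carrier (UP ?Z)" and q: "q \<in> carrier (UP ?Z)"
    have cl: "p \<in> carrier (UP A)" "q \<in> carrier (UP A)"
      using ring_hom_closed[OF iZ p] ring_hom_closed[OF iZ q] by auto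
    show \<phi>p: "\<phi> p \<in> carrier (UP ?W)" using p img by blast
    have \<phi>q: "\<phi> q \<in> carrier (UP ?W)" using q img by blast
    show "\<phi> (p \<otimes>\<^bsub>UP ?Z\<^esub> q) = \<phi> p \<otimes>\<^bsub>UP ?W\<^esub> \<phi> q"
      using ring_hom_mult[OF iZ p q] ring_hom_mult[OF iW \<phi>p \<phi>q] \<phi>.hom_mult[OF cl] by simp
    show "\<phi> (p \<oplus>\<^bsub>UP ?Z\<^esub> q) = \<phi> p \<oplus>\<^bsub>UP ?W\<^esub> \<phi> q"
      using ring_hom_add[OF iZ p q] ring_hom_add[OF iW \<phi>p \<phi>q] \<phi>.hom_add[OF cl] by simp
  next
    show "\<phi> \<one>\<^bsub>UP ?Z\<^esub> = \<one>\<^bsub>UP ?W\<^esub>"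
      using ring_hom_one[OF iZ] ring_hom_one[OF iW] \<phi>.hom_one by simp
  qed
  \<comment> \<open>the two polynomial rings over a center and over the whole algebra share their elements\<close>
  have X_eq: "poly_X ?Z = poly_X A" "poly_X ?W = poly_X B"
    by (simp_all add: fun_eq_iff cring.poly_X_apply[OF Ac] cring.poly_X_apply[OF Bc]
        cring.poly_X_apply[OF Z] cring.poly_X_apply[OF W])
  define f where "f = \<phi> (poly_X A)"
  have f_W: "f \<in> carrier (UP ?W)"
    using ring_hom_closed[OF \<phi>_center cring.poly_X_closed[OF Z]] by (simp add: f_def X_eq)
  have "poly_X ?W \<in> \<phi> ` carrier (UP ?Z)"
    unfolding img by (rule cring.poly_X_closed[OF W])
  then obtain g where g: "g \<in> carrier (UP ?Z)" "\<phi> g = poly_X ?W"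
    by (rule imageE) (simp add: that)
  have lin: "\<And>P. primeideal P ?W \<Longrightarrow> f 1 \<notin> P" "\<And>P i. \<lbrakk>primeideal P ?W; i \<ge> 2\<rbrakk> \<Longrightarrow> f i \<in> P"
    using linear_modulo_primes[OF Z pi W \<phi>_center g] by (simp_all add: f_def X_eq)
  obtain c q q' where c: "c \<in> carrier ?W" and q: "q \<in> carrier (UP ?W)" and q': "q' \<in> carrier (UP ?W)"
    and Xc_W: "poly_X ?W \<ominus>\<^bsub>UP ?W\<^esub> poly_C ?W c = f \<otimes>\<^bsub>UP ?W\<^esub> q"
    and f_Wq: "f = (poly_X ?W \<ominus>\<^bsub>UP ?W\<^esub> poly_C ?W c) \<otimes>\<^bsub>UP ?W\<^esub> q'"
    using cring.root_if_linear_modulo_primes[OF W f_W lin] by blast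
  have cB: "c \<in> carrier B" "c \<in> poisson_center B" using c PB.center_subset by auto
  have C_eq: "poly_C ?W c = poly_C B c"
    by (simp add: fun_eq_iff cring.poly_C_apply[OF Bc cB(1)] cring.poly_C_apply[OF W c])
  have fB: "f \<in> carrier (UP B)" and qB: "q \<in> carrier (UP B)" and q'B: "q' \<in> carrier (UP B)"
    using ring_hom_closed[OF iW] f_W q q' by auto
  note CB = cring.poly_C_closed[OF Bc] and XB = cring.poly_X_closed[OF Bc]
  note CA = cring.poly_C_closed[OF Ac] and XA = cring.poly_X_closed[OF Ac]
  have minus_eq: "poly_X ?W \<ominus>\<^bsub>UP ?W\<^esub> poly_C ?W c = poly_X B \<ominus>\<^bsub>UP B\<^esub> poly_C B c"
  proof -
    have inv: "\<ominus>\<^bsub>UP ?W\<^esub> poly_C ?W c \<in> carrier (UP ?W)"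
      by (rule cring.cring_simprules(3)[OF cring.UP_is_cring[OF W] cring.poly_C_closed[OF W c]])
    show ?thesis
      using iW.hom_add[OF cring.poly_X_closed[OF W] inv]
        iW.hom_a_inv[OF cring.poly_C_closed[OF W c]]
      by (simp add: a_minus_def X_eq C_eq)
  qed
  have Xc: "poly_X B \<ominus>\<^bsub>UP B\<^esub> poly_C B c = f \<otimes>\<^bsub>UP B\<^esub> q"
    using Xc_W iW.hom_mult[OF f_W q] minus_eq by simp
  have f_eq: "f = (poly_X B \<ominus>\<^bsub>UP B\<^esub> poly_C B c) \<otimes>\<^bsub>UP B\<^esub> q'"
  proof -
    have "f \<otimes>\<^bsub>UP ?W\<^esub> q \<in> carrier (UP ?W)"
      by (rule cring.cring_simprules(5)[OF cring.UP_is_cring[OF W] f_W q])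
    then show ?thesis
      using f_Wq iW.hom_mult[OF _ q'] minus_eq Xc_W by metis
  qed
  obtain e where e: "e \<in> ring_hom (UP B) B" "\<And>b. b \<in> carrier B \<Longrightarrow> e (poly_C B b) = b" "e (poly_X B) = c"
    using cring.evaluation_hom[OF Bc cB(1)] by blast
  interpret e: ring_hom_cring "UP B" B e by (rule ring_hom_cringI[OF UB.is_cring Bc e(1)])
  have eXc: "e (poly_X B \<ominus>\<^bsub>UP B\<^esub> poly_C B c) = \<zero>\<^bsub>B\<^esub>"
    using cB CB XB e by (simp add: UB.minus_eq cring.cring_simprules[OF Bc])
  have ef: "e f = \<zero>\<^bsub>B\<^esub>"
    using e.hom_mult[of "poly_X B \<ominus>\<^bsub>UP B\<^esub> poly_C B c" q'] eXc cB CB XB q'B f_eq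
      e.hom_closed[OF q'B] by (simp add: cring.cring_simprules[OF Bc])
  define h where "h = e \<circ> (\<phi> \<circ> poly_C A)"
  have h_hom: "h \<in> ring_hom A B"
    unfolding h_def
    using ring_hom_trans[OF ring_hom_trans[OF cring.poly_C_hom[OF Ac] hom] e(1)] by (simp add: comp_assoc)
  interpret h: ring_hom_cring A B h by (rule ring_hom_cringI[OF Ac Bc h_hom])
  have h_zero: "a = \<zero>\<^bsub>A\<^esub>" if a: "a \<in> carrier A" and ha: "h a = \<zero>\<^bsub>B\<^esub>" for a
  proof -
    have \<phi>a: "\<phi> (poly_C A a) \<in> carrier (UP B)" using a CA by simp
    obtain r where r: "r \<in> carrier (UP B)" "\<phi> (poly_C A a)
        = (poly_X B \<ominus>\<^bsub>UP B\<^esub> poly_C B c) \<otimes>\<^bsub>UP B\<^esub> r \<oplus>\<^bsub>UP B\<^esub> poly_C B (e (\<phi> (poly_C A a)))"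
      using cring.factor_theorem[OF Bc cB(1) e \<phi>a] by blast
    have "poly_C B \<zero>\<^bsub>B\<^esub> = \<zero>\<^bsub>UP B\<^esub>"
      by (simp add: fun_eq_iff cring.poly_C_apply[OF Bc] cring.UP_zero_apply[OF Bc])
    then have "\<phi> (poly_C A a) = f \<otimes>\<^bsub>UP B\<^esub> q \<otimes>\<^bsub>UP B\<^esub> r"
      using r ha fB qB unfolding Xc by (simp add: h_def)
    also have "\<dots> = f \<otimes>\<^bsub>UP B\<^esub> (q \<otimes>\<^bsub>UP B\<^esub> r)" using fB qB r(1) by (simp add: UB.m_assoc)
    finally have eq: "\<phi> (poly_C A a) = f \<otimes>\<^bsub>UP B\<^esub> (q \<otimes>\<^bsub>UP B\<^esub> r)" .
    have "q \<otimes>\<^bsub>UP B\<^esub> r \<in> carrier (UP B)" using qB r(1) by simp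
    then have "q \<otimes>\<^bsub>UP B\<^esub> r \<in> \<phi> ` carrier (UP A)"
      unfolding bij_betw_imp_surj_on[OF bij] .
    then obtain s where s: "s \<in> carrier (UP A)" "\<phi> s = q \<otimes>\<^bsub>UP B\<^esub> r"
      by (rule imageE) (simp add: that)
    have "\<phi> (poly_C A a) = \<phi> (poly_X A \<otimes>\<^bsub>UP A\<^esub> s)"
      using eq s XA by (simp add: f_def)
    then have "poly_C A a = poly_X A \<otimes>\<^bsub>UP A\<^esub> s"
      by (rule inj_onD[OF bij_betw_imp_inj_on[OF bij]]) (use CA[OF a] XA s(1) in auto)
    then have "poly_C A a 0 = (poly_X A \<otimes>\<^bsub>UP A\<^esub> s) 0" by simp
    then show ?thesis
      using a s(1) by (simp add: cring.poly_C_apply[OF Ac] cring.poly_X_mult_apply[OF Ac])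
  qed
  have h_inj: "inj_on h (carrier A)"
  proof (rule inj_onI)
    fix a b assume a: "a \<in> carrier A" and b: "b \<in> carrier A" and eq: "h a = h b"
    have mb: "\<ominus>\<^bsub>A\<^esub> b \<in> carrier A" by (rule cring.cring_simprules(3)[OF Ac b])
    have "h (a \<oplus>\<^bsub>A\<^esub> \<ominus>\<^bsub>A\<^esub> b) = \<zero>\<^bsub>B\<^esub>"
      using a b mb eq h.hom_closed[OF b] by (simp add: cring.cring_simprules[OF Bc])
    then have "a \<ominus>\<^bsub>A\<^esub> b = \<zero>\<^bsub>A\<^esub>"
      unfolding a_minus_def
      by (rule h_zero[rotated]) (rule cring.cring_simprules(1)[OF Ac a mb])
    then show "a = b" using ring.r_right_minus_eq[OF cring.axioms(1)[OF Ac] a b] by simp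
  qed
  have h_surj: "b \<in> h ` carrier A" if b: "b \<in> carrier B" for b
  proof -
    have "poly_C B b \<in> \<phi> ` carrier (UP A)"
      unfolding bij_betw_imp_surj_on[OF bij] by (rule CB[OF b])
    then obtain p where p: "p \<in> carrier (UP A)" "\<phi> p = poly_C B b"
      by (rule imageE) (simp add: that)
    let ?p = "\<lambda>n. p (Suc n)"
    have p0: "p 0 \<in> carrier A" using p(1) by (simp add: UP_carrier_iff)
    have ps: "?p \<in> carrier (UP A)" by (rule cring.poly_decompose(1)[OF Ac p(1)])
    have "b = e (\<phi> (poly_C A (p 0) \<oplus>\<^bsub>UP A\<^esub> poly_X A \<otimes>\<^bsub>UP A\<^esub> ?p))"
      using cring.poly_decompose(2)[OF Ac p(1)] p(2) e(2)[OF b] by simp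
    also have "\<dots> = h (p 0) \<oplus>\<^bsub>B\<^esub> e f \<otimes>\<^bsub>B\<^esub> e (\<phi> ?p)"
      using p0 ps CA XA fB by (simp add: h_def f_def)
    also have "\<dots> = h (p 0)"
      using ef h.hom_closed[OF p0] e.hom_closed[OF \<phi>.hom_closed[OF ps]]
      by (simp add: cring.cring_simprules[OF Bc])
    finally show ?thesis using p0 by blast
  qed
  have "h \<in> ring_iso A B"
    unfolding ring_iso_def bij_betw_def using h_hom h_inj h_surj h.hom_closed by auto
  moreover have "h (r \<odot>\<^bsub>A\<^esub> a) = r \<odot>\<^bsub>B\<^esub> h a" if r: "r \<in> carrier K" and a: "a \<in> carrier A" for r a
  proof -
    have \<phi>a: "\<phi> (poly_C A a) \<in> carrier (UP B)" using a CA by simp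
    have rB: "r \<odot>\<^bsub>B\<^esub> \<one>\<^bsub>B\<^esub> \<in> carrier B" using r PB.smult_closed by simp
    have "h (r \<odot>\<^bsub>A\<^esub> a) = e (r \<odot>\<^bsub>poisson_poly B\<^esub> \<phi> (poly_C A a))"
      using r a CA by (simp add: h_def PA.poly_C_smult \<phi>_smult)
    also have "\<dots> = (r \<odot>\<^bsub>B\<^esub> \<one>\<^bsub>B\<^esub>) \<otimes>\<^bsub>B\<^esub> h a"
      unfolding PB.poly_smult_eq_C_mult[OF r \<phi>a]
      using e.hom_mult[OF CB[OF rB] \<phi>a] e(2)[OF rB] by (simp add: h_def)
    also have "\<dots> = r \<odot>\<^bsub>B\<^esub> h a"
      using PB.smult_assoc2[OF r cring.cring_simprules(6)[OF Bc] h.hom_closed[OF a]] h.hom_closed[OF a]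
      by (simp add: cring.cring_simprules[OF Bc])
    finally show ?thesis .
  qed
  moreover have "h \<lbrace>a, b\<rbrace>\<^bsub>A\<^esub> = \<lbrace>h a, h b\<rbrace>\<^bsub>B\<^esub>" if a: "a \<in> carrier A" and b: "b \<in> carrier A" for a b
  proof -
    have "h \<lbrace>a, b\<rbrace>\<^bsub>A\<^esub> = e \<lbrace>\<phi> (poly_C A a), \<phi> (poly_C A b)\<rbrace>\<^bsub>poisson_poly B\<^esub>"
      using \<phi>_bracket[OF CA[OF a] CA[OF b]] by (simp add: h_def PA.poly_bracket_C_C[OF a b])
    also have "\<dots> = \<lbrace>h a, h b\<rbrace>\<^bsub>B\<^esub>"
      using PB.evaluation_preserves_bracket[OF cB(2) e] a b CA by (simp add: h_def)
    finally show ?thesis .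
  qed
  ultimately have "h \<in> poisson_iso K A B" by (simp add: poisson_iso_def)
  then show ?thesis by (auto simp: poisson_isomorphic_def)
qed

text \<open>
  The image of a field is a field or the zero ring: \<open>n = 1\<close> serves for zero, and \<open>n = 0\<close> for the
  other elements, whose inverses come from inverses in \<open>K\<close>.
\<close>

lemma trivial_center_strongly_pi_regular:
  assumes A: "poisson_algebra K A" and triv: "trivial_poisson_center K A"
  shows "strongly_pi_regular (A\<lparr>carrier := poisson_center A\<rparr>)"
  unfolding strongly_pi_regular_def
proof
  interpret poisson_algebra K A by (rule A)
  let ?Z = "A\<lparr>carrier := poisson_center A\<rparr>"
  interpret Z: cring ?Z by (rule center_cring)
  fix z assume z: "z \<in> carrier ?Z"
  then obtain r where r: "r \<in> carrier K" "z = r \<odot>\<^bsub>A\<^esub> \<one>\<^bsub>A\<^esub>"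
    using triv by (auto simp: trivial_poisson_center_def)
  have one: "\<one>\<^bsub>A\<^esub> \<in> carrier A" by (rule cring.cring_simprules(6)[OF M_cring])
  show "\<exists>n::nat. \<exists>y \<in> carrier ?Z. z [^]\<^bsub>?Z\<^esub> n = z [^]\<^bsub>?Z\<^esub> Suc n \<otimes>\<^bsub>?Z\<^esub> y"
  proof (cases "r = \<zero>\<^bsub>K\<^esub>")
    case True
    then have "z = \<zero>\<^bsub>?Z\<^esub>" using r one by simp
    then have "z [^]\<^bsub>?Z\<^esub> (1::nat) = z [^]\<^bsub>?Z\<^esub> Suc 1 \<otimes>\<^bsub>?Z\<^esub> \<one>\<^bsub>?Z\<^esub>" by simp
    then show ?thesis using Z.one_closed by blast
  next
    case False
    then obtain s where s: "s \<in> carrier K" "r \<otimes>\<^bsub>K\<^esub> s = \<one>\<^bsub>K\<^esub>"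
      using r(1) K.field_Units by (auto simp: Units_def)
    let ?y = "s \<odot>\<^bsub>A\<^esub> \<one>\<^bsub>A\<^esub>"
    have y: "?y \<in> carrier ?Z" using s(1) triv by (auto simp: trivial_poisson_center_def)
    have "z \<otimes>\<^bsub>A\<^esub> ?y = \<one>\<^bsub>A\<^esub>"
      using r s one smult_assoc2[OF r(1) one, of ?y] smult_assoc1[OF r(1) s(1) one]
      by (simp add: cring.cring_simprules[OF M_cring])
    then have "z [^]\<^bsub>?Z\<^esub> (0::nat) = z [^]\<^bsub>?Z\<^esub> Suc 0 \<otimes>\<^bsub>?Z\<^esub> ?y"
      using Z.l_one[OF z] by simp
    then show ?thesis using y by blast
  qed
qed

theorem theorem1p4:
  fixes K :: "'k ring" and A :: "('k, 'a) poisson"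
  assumes "field K" and "poisson_algebra K A"
  shows "(noetherian_ring A \<and> artinian_ring (A\<lparr>carrier := poisson_center A\<rparr>)
            \<longrightarrow> poisson_cancellative TYPE('b) K A)
       \<and> (trivial_poisson_center K A \<longrightarrow> poisson_cancellative TYPE('b) K A)"
proof -
  have cancel: "poisson_cancellative TYPE('b) K A"
    if "strongly_pi_regular (A\<lparr>carrier := poisson_center A\<rparr>)"
    unfolding poisson_cancellative_def using poisson_cancellation[OF assms(2) _ that] by blast
  show ?thesis
    using cancel artinian_imp_strongly_pi_regular[OF _ poisson_algebra.center_cring[OF assms(2)]]
      trivial_center_strongly_pi_regular[OF assms(2)] by blast
qed

end
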